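(* Let $M$ be a matroid with dual matroid $M^*$. Suppose that there exists an integer $\ell\geqslant 4$ such that every circuit of $M$ and every circuit of $M^*$ has length (cardinality) at least $\ell$ and at most $(\ell-2)^2(\ell^2-4\ell+2)$. Then $$T_M(2,0)\,T_M(0,2)\geqslant T_M(1,1)^2 .$$
   Context: Matroids are on finite ground sets. For a matroid $M$ with ground set $E$ and rank function $r$, the Tutte polynomial is $T_M(x,y)=\sum_{S\subseteq E}(x-1)^{r(E)-r(S)}(y-1)^{|S|-r(S)}$ (with the convention $0^0=1$). A circuit is a minimal dependent set, and the dual $M^*$ is the matroid on $E$ whose bases are the complements of the bases of $M$. *)

theory Defs
  imports Complex_Main
begin

text \<open>
  A matroid is given by its finite ground set \<open>E\<close> and its independence predicate \<open>indep\<close>.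
\<close>

locale matroid =
  fixes E :: "'a set" and indep :: "'a set \<Rightarrow> bool"
  assumes finite_ground: "finite E"
    and indep_subset_ground: "indep X \<Longrightarrow> X \<subseteq> E"
    and indep_empty: "indep {}"
    and indep_mono: "indep Y \<Longrightarrow> X \<subseteq> Y \<Longrightarrow> indep X"
    and indep_augment:
      "indep X \<Longrightarrow> indep Y \<Longrightarrow> card X < card Y \<Longrightarrow> \<exists>y\<in>Y - X. indep (insert y X)"

definition matroid_basis :: "('a set \<Rightarrow> bool) \<Rightarrow> 'a set \<Rightarrow> bool" where
  "matroid_basis indep B \<longleftrightarrow> indep B \<and> (\<forall>X. indep X \<and> B \<subseteq> X \<longrightarrow> X = B)"

definition matroid_circuit :: "'a set \<Rightarrow> ('a set \<Rightarrow> bool) \<Rightarrow> 'a set \<Rightarrow> bool" where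
  "matroid_circuit E indep C \<longleftrightarrow> C \<subseteq> E \<and> \<not> indep C \<and> (\<forall>X. X \<subset> C \<longrightarrow> indep X)"

definition matroid_rank :: "('a set \<Rightarrow> bool) \<Rightarrow> 'a set \<Rightarrow> nat" where
  "matroid_rank indep S = Max (card ` {X. X \<subseteq> S \<and> indep X})"

text \<open>
  Independence in the dual matroid: containment in the complement of a basis. That this is a matroid
  on \<open>E\<close> whose bases are exactly the complements of the bases is proved below.
\<close>

definition dual_indep :: "'a set \<Rightarrow> ('a set \<Rightarrow> bool) \<Rightarrow> 'a set \<Rightarrow> bool" where
  "dual_indep E indep X \<longleftrightarrow> (\<exists>B. matroid_basis indep B \<and> X \<subseteq> E - B)"

text \<open>
  The Tutte polynomial as a function of its two variables. In a matroid the subtractions in the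
  exponents are never truncated (lemmas \<open>rank_mono\<close> and \<open>rank_le_card\<close> below), and \<open>0 ^ 0 = 1\<close>.
\<close>

definition tutte :: "'a set \<Rightarrow> ('a set \<Rightarrow> bool) \<Rightarrow> real \<Rightarrow> real \<Rightarrow> real" where
  "tutte E indep x y =
     (\<Sum>S\<in>Pow E. (x - 1) ^ (matroid_rank indep E - matroid_rank indep S)
                 * (y - 1) ^ (card S - matroid_rank indep S))"

context matroid
begin

lemma indep_finite: "indep X \<Longrightarrow> finite X"
  using finite_ground indep_subset_ground finite_subset by blast

lemma finite_indep_subsets: "finite {X. X \<subseteq> S \<and> indep X}"
  by (rule finite_subset[of _ "Pow E"]) (use finite_ground indep_subset_ground in auto)

lemma rank_mono: "S \<subseteq> T \<Longrightarrow> matroid_rank indep S \<le> matroid_rank indep T"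
  unfolding matroid_rank_def
  by (rule Max_mono) (use finite_indep_subsets indep_empty in auto)

lemma rank_le_card: "finite S \<Longrightarrow> matroid_rank indep S \<le> card S"
  unfolding matroid_rank_def
  by (subst Max_le_iff) (use finite_indep_subsets indep_empty card_mono in auto)

lemma augment_within:
  assumes "indep I" "indep J" "card I \<le> card J"
  shows "\<exists>K. indep K \<and> I \<subseteq> K \<and> K \<subseteq> I \<union> J \<and> card K = card J"
  using assms
proof (induction "card J - card I" arbitrary: I)
  case 0
  then show ?case by (intro exI[of _ I]) auto
next
  case (Suc n)
  then have "card I < card J" by linarith
  then obtain y where y: "y \<in> J - I" "indep (insert y I)"
    using indep_augment[of I J] Suc.prems by auto
  have c: "card (insert y I) = Suc (card I)"
    using y Suc.prems indep_finite by auto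
  obtain K where "indep K" "insert y I \<subseteq> K" "K \<subseteq> insert y I \<union> J" "card K = card J"
    using Suc.hyps(1)[of "insert y I"] Suc.hyps(2) y(2) c Suc.prems(2) \<open>card I < card J\<close>
    by (metis Suc_leI diff_Suc_1 diff_Suc_eq_diff_pred Suc_diff_Suc)
  then show ?case using y by (intro exI[of _ K]) auto
qed

lemma indep_card_le_basis: "matroid_basis indep B \<Longrightarrow> indep X \<Longrightarrow> card X \<le> card B"
  unfolding matroid_basis_def by (metis indep_augment Diff_iff insertI1 not_le subset_insertI)

lemma basis_if_card_eq:
  assumes "matroid_basis indep B" "indep X" "card X = card B"
  shows "matroid_basis indep X"
  unfolding matroid_basis_def
  using assms indep_card_le_basis indep_finite by (metis card_seteq)

lemma basis_exists: "\<exists>B. matroid_basis indep B"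
proof -
  let ?F = "{X. X \<subseteq> E \<and> indep X}"
  obtain B where "B \<in> ?F" "\<forall>X\<in>?F. B \<subseteq> X \<longrightarrow> X = B"
    using finite_has_maximal[OF finite_indep_subsets[of E]] indep_empty
    by (metis (lifting) bot_least empty_iff mem_Collect_eq)
  then have "matroid_basis indep B"
    unfolding matroid_basis_def using indep_subset_ground by auto
  then show ?thesis ..
qed

theorem dual_matroid: "matroid E (dual_indep E indep)"
proof
  show "finite E" by (rule finite_ground)
  show "X \<subseteq> E" if "dual_indep E indep X" for X
    using that by (auto simp: dual_indep_def)
  show "dual_indep E indep {}"
    using basis_exists by (auto simp: dual_indep_def)
  show "dual_indep E indep X" if "dual_indep E indep Y" "X \<subseteq> Y" for X Y
    using that unfolding dual_indep_def by blast
next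
  fix X Y
  assume X: "dual_indep E indep X" and Y: "dual_indep E indep Y" and less: "card X < card Y"
  obtain B1 where B1: "matroid_basis indep B1" "X \<subseteq> E - B1"
    using X by (auto simp: dual_indep_def)
  obtain B2 where B2: "matroid_basis indep B2" "Y \<subseteq> E - B2"
    using Y by (auto simp: dual_indep_def)
  have ind: "indep B1" "indep B2" "indep (B2 - X)"
    using B1 B2 indep_mono[of B2 "B2 - X"] by (auto simp: matroid_basis_def)
  have fin: "finite X" "finite Y" "finite B2"
    using B1 B2 ind finite_ground indep_finite by (auto intro: finite_subset)
  obtain K where K: "indep K" "B2 - X \<subseteq> K" "K \<subseteq> (B2 - X) \<union> B1" "card K = card B1"
    using augment_within[of "B2 - X" B1] ind indep_card_le_basis[OF B1(1)] by blast
  have K_basis: "matroid_basis indep K"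
    using basis_if_card_eq[OF B1(1)] K by blast
  have "\<exists>y\<in>Y - X. y \<notin> K"
  proof (rule ccontr)
    assume "\<not> ?thesis"
    then have sub: "(B2 - X) \<union> (Y - X) \<subseteq> K" using K by auto
    have "card (B2 - X) + card (Y - X) = card ((B2 - X) \<union> (Y - X))"
      using fin B2 by (intro card_Un_disjoint[symmetric]) auto
    also have "\<dots> \<le> card K" using sub K indep_finite by (intro card_mono) auto
    also have "\<dots> \<le> card B2" using indep_card_le_basis[OF B2(1) K(1)] .
    also have "\<dots> = card (B2 - X) + card (B2 \<inter> X)"
      using fin card_Diff_subset_Int[of B2 X] card_mono[of B2 "B2 \<inter> X"] by auto
    finally have "card (Y - X) \<le> card (B2 \<inter> X)" by simp
    also have "\<dots> \<le> card (X - Y)"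
      using fin B2 by (intro card_mono) auto
    finally have "card (Y - X) \<le> card (X - Y)" .
    moreover have "card (X - Y) < card (Y - X)"
      using less fin card_less_sym_Diff by blast
    ultimately show False by simp
  qed
  then obtain y where y: "y \<in> Y - X" "y \<notin> K" by blast
  have "insert y X \<subseteq> E - K" using y K B1 B2 by auto
  then show "\<exists>y\<in>Y - X. dual_indep E indep (insert y X)"
    using y K_basis unfolding dual_indep_def by blast
qed

theorem dual_basis_iff:
  "matroid_basis (dual_indep E indep) X \<longleftrightarrow> (\<exists>B. matroid_basis indep B \<and> X = E - B)"
proof
  assume "matroid_basis (dual_indep E indep) X"
  then show "\<exists>B. matroid_basis indep B \<and> X = E - B"
    unfolding matroid_basis_def[of "dual_indep E indep"] dual_indep_def by blast
next
  assume "\<exists>B. matroid_basis indep B \<and> X = E - B"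
  then obtain B where B: "matroid_basis indep B" "X = E - B" by blast
  have "Z = X" if Z: "matroid_basis indep B'" "Z \<subseteq> E - B'" "X \<subseteq> Z" for Z B'
  proof -
    have "indep B" "B' \<subseteq> B"
      using B Z indep_subset_ground[of B'] by (auto simp: matroid_basis_def)
    then have "B' = B" using Z(1) by (auto simp: matroid_basis_def)
    then show ?thesis using Z B by auto
  qed
  then show "matroid_basis (dual_indep E indep) X"
    using B unfolding matroid_basis_def[of "dual_indep E indep"] dual_indep_def by blast
qed

end

end

theory Submission
  imports Defs "HOL-Library.FuncSet" "HOL-Analysis.Convex"
begin

text \<open>
  Averaging Crapo's activity expansion over random orders of \<open>E\<close> writes the Tutte polynomial as a sum
  over bases \<open>B\<close> of an expectation that depends only on the bipartite exchange graph between \<open>B\<close>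
  and \<open>E - B\<close>: an element is active if its label exceeds the labels of all its neighbours. By
  Cauchy--Schwarz over the bases it suffices that for each exchange graph the expectations of
  \<open>2 ^ ia * 0 ^ ea\<close> and \<open>0 ^ ia * 2 ^ ea\<close> have product at least 1.

  Both are bounded from below by forcing the labels on the side that must not be active into
  \<open>[0, 1 - s]\<close>, and then applying Harris' inequality twice, first to the labels of the other side (whose
  law is tilted by the factors \<open>1 + [active]\<close>) and then to the restricted labels. The two bounds multiply
  to a product over the vertices: a vertex of degree \<open>d\<close> contributes, with \<open>r = (1 - s) / (1 + s)\<close>,
  \<open>(1 - s\<^sup>2) (1 - r ^ d / (d + 1)) (1 + r / (d + 1))\<close>.
  The degrees are circuit and cocircuit lengths minus 1, and \<open>s = 1 / (l - 2)\<^sup>2\<close> makes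
  this larger than 1 for all admissible degrees. To avoid measure theory, labels are drawn from \<open>{..<N}\<close>
  with ties broken by a fixed order, and \<open>N\<close> is taken large.
\<close>

subsection \<open>Activities\<close>

lemma sum_Pow_power_card:
  fixes z :: "'b::comm_semiring_1"
  assumes "finite A"
  shows "(\<Sum>X\<in>Pow A. z ^ card X) = (1 + z) ^ card A"
  using assms
proof (induction A rule: finite_induct)
  case (insert a A)
  have inj: "inj_on (insert a) (Pow A)"
    using insert(2) by (intro inj_onI) (metis PowD insert_ident subsetD)
  have "(\<Sum>X\<in>Pow (insert a A). z ^ card X)
      = (\<Sum>X\<in>Pow A. z ^ card X) + (\<Sum>X\<in>insert a ` Pow A. z ^ card X)"
    unfolding Pow_insert using insert by (intro sum.union_disjoint) auto
  also have "(\<Sum>X\<in>insert a ` Pow A. z ^ card X) = (\<Sum>X\<in>Pow A. z * z ^ card X)"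
    unfolding sum.reindex[OF inj] o_def
  proof (rule sum.cong[OF refl])
    fix X assume "X \<in> Pow A"
    then have "finite X" "a \<notin> X" using insert finite_subset by auto
    then show "z ^ card (insert a X) = z * z ^ card X" by simp
  qed
  also have "\<dots> = z * (\<Sum>X\<in>Pow A. z ^ card X)" by (simp add: sum_distrib_left)
  finally show ?case using insert by (simp add: algebra_simps)
qed simp

lemma card_insert_Diff_singleton:
  assumes "finite B" "a \<in> B" "b \<notin> B"
  shows "card (insert b (B - {a})) = card B"
  using assms card_Suc_Diff1[of B a] by simp

text \<open>Adjacency in the exchange graph of \<open>B\<close>, with \<open>a\<close> meant inside
  \<open>B\<close> and \<open>b\<close> outside. The neighbours of \<open>b\<close> complete it to
  its fundamental circuit, those of \<open>a\<close> complete it to its fundamental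
  cocircuit.\<close>

definition exchangeable :: "('a set \<Rightarrow> bool) \<Rightarrow> 'a set \<Rightarrow> 'a \<Rightarrow> 'a \<Rightarrow> bool" where
  "exchangeable indep B a b \<longleftrightarrow> matroid_basis indep (insert b (B - {a}))"

text \<open>Activities are taken with respect to the largest key: an element is active if its key is the
  largest in its fundamental circuit or cocircuit.\<close>

definition int_active :: "'a set \<Rightarrow> ('a set \<Rightarrow> bool) \<Rightarrow> ('a \<Rightarrow> nat) \<Rightarrow> 'a set \<Rightarrow> 'a set" where
  "int_active E indep key B = {a \<in> B. \<forall>b\<in>E - B. exchangeable indep B a b \<longrightarrow> key b < key a}"

definition ext_active :: "'a set \<Rightarrow> ('a set \<Rightarrow> bool) \<Rightarrow> ('a \<Rightarrow> nat) \<Rightarrow> 'a set \<Rightarrow> 'a set" where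
  "ext_active E indep key B = {b \<in> E - B. \<forall>a\<in>B. exchangeable indep B a b \<longrightarrow> key a < key b}"

section \<open>Basis exchange, rank, and Crapo's partition of the power set\<close>

context matroid
begin

lemma basis_indep: "matroid_basis indep B \<Longrightarrow> indep B"
  by (simp add: matroid_basis_def)

lemma basis_subset: "matroid_basis indep B \<Longrightarrow> B \<subseteq> E"
  using basis_indep indep_subset_ground by blast

lemma basis_finite: "matroid_basis indep B \<Longrightarrow> finite B"
  using basis_indep indep_finite by blast

lemma finite_bases: "finite {B. matroid_basis indep B}"
  by (rule finite_subset[of _ "Pow E"]) (use basis_subset finite_ground in auto)

text \<open>\<open>insert e X\<close> is the fundamental circuit of \<open>e\<close>, obtained from
  a minimal choice of \<open>X\<close>. For \<open>f\<close> in \<open>X\<close>, the independent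
  set \<open>insert e (X - {f})\<close> extends to full size inside \<open>insert e B\<close>; the
  result cannot contain \<open>f\<close>, so it is \<open>insert e (B - {f})\<close>.\<close>

lemma minimal_spanning_subset:
  assumes B: "matroid_basis indep B" and e: "e \<notin> B"
  obtains X where "X \<subseteq> B" "\<not> indep (insert e X)" "\<And>Y. Y \<subset> X \<Longrightarrow> indep (insert e Y)"
    "\<And>f. f \<in> X \<Longrightarrow> matroid_basis indep (insert e (B - {f}))"
proof -
  have fin: "finite B" using B by (rule basis_finite)
  let ?F = "{X. X \<subseteq> B \<and> \<not> indep (insert e X)}"
  have "\<not> indep (insert e B)" using B e unfolding matroid_basis_def by blast
  then have "B \<in> ?F" by simp
  moreover have "finite ?F" using fin by (intro finite_subset[of ?F "Pow B"]) auto
  ultimately obtain X where X: "X \<in> ?F" "\<forall>Y\<in>?F. Y \<subseteq> X \<longrightarrow> Y = X"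
    using finite_has_minimal[of ?F] by (metis (lifting) empty_iff)
  have min: "indep (insert e Y)" if "Y \<subset> X" for Y
    using X that by (metis (no_types, lifting) mem_Collect_eq order_trans psubset_eq)
  have "matroid_basis indep (insert e (B - {f}))" if f: "f \<in> X" for f
  proof -
    let ?I = "insert e (X - {f})"
    have fB: "f \<in> B" "f \<noteq> e" "e \<notin> X" using X f e by auto
    have I: "indep ?I" using f by (intro min) blast
    have "card ?I \<le> card B" by (rule indep_card_le_basis[OF B I])
    then obtain K where K: "indep K" "?I \<subseteq> K" "K \<subseteq> ?I \<union> B" "card K = card B"
      using augment_within[OF I basis_indep[OF B]] by blast
    have "f \<notin> K"
    proof
      assume "f \<in> K"
      then have "insert e X \<subseteq> K" using K by blast
      then show False using X indep_mono[OF K(1)] by blast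
    qed
    then have "K \<subseteq> insert e (B - {f})" using K X by blast
    moreover have "card (insert e (B - {f})) = card B"
      using fin fB e by (intro card_insert_Diff_singleton) auto
    ultimately have "K = insert e (B - {f})" using K fin by (intro card_subset_eq) auto
    then show ?thesis using basis_if_card_eq[OF B K(1) K(4)] by simp
  qed
  then show ?thesis using that X min by blast
qed

text \<open>Let \<open>insert e X\<close> be the fundamental circuit with respect to
  \<open>B'\<close>, and extend \<open>X\<close> to a set \<open>K\<close> of full size inside
  \<open>X \<union> B\<close>. It avoids \<open>e\<close>, so augmenting \<open>B - {e}\<close> from
  \<open>K\<close> yields an element outside \<open>B\<close>, hence in \<open>X\<close>, and this
  \<open>f\<close> serves both exchanges.\<close>

lemma symmetric_exchange:
  assumes B: "matroid_basis indep B" and B': "matroid_basis indep B'" and e: "e \<in> B - B'"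
  obtains f where "f \<in> B' - B" "exchangeable indep B e f" "exchangeable indep B' f e"
proof -
  have "e \<notin> B'" using e by simp
  then obtain X where X: "X \<subseteq> B'" "\<not> indep (insert e X)" "\<And>Y. Y \<subset> X \<Longrightarrow> indep (insert e Y)"
    "\<And>f. f \<in> X \<Longrightarrow> matroid_basis indep (insert e (B' - {f}))"
    using minimal_spanning_subset[OF B'] by metis
  have iX: "indep X" using X(1) basis_indep[OF B'] indep_mono by blast
  obtain K where K: "indep K" "X \<subseteq> K" "K \<subseteq> X \<union> B" "card K = card B"
    using augment_within[OF iX basis_indep[OF B] indep_card_le_basis[OF B iX]] by blast
  have eK: "e \<notin> K" using X(2) K indep_mono[of K "insert e X"] by blast
  have "card (B - {e}) < card K"
    using K(4) e basis_finite[OF B] by (metis card_Diff1_less DiffD1)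
  then obtain f where f: "f \<in> K - (B - {e})" "indep (insert f (B - {e}))"
    using indep_augment[of "B - {e}" K] indep_mono[OF basis_indep[OF B]] K(1) by blast
  have fX: "f \<in> X" "f \<notin> B" "f \<in> B'" using f eK K X(1) by auto
  have "card (insert f (B - {e})) = card B"
    using fX e basis_finite[OF B] by (intro card_insert_Diff_singleton) auto
  then have "matroid_basis indep (insert f (B - {e}))" by (rule basis_if_card_eq[OF B f(2)])
  then show ?thesis using that[of f] fX X(4) unfolding exchangeable_def by simp
qed

lemma rank_witness:
  obtains I where "I \<subseteq> S" "indep I" "card I = matroid_rank indep S"
proof -
  have "matroid_rank indep S \<in> card ` {X. X \<subseteq> S \<and> indep X}"
    unfolding matroid_rank_def using finite_indep_subsets indep_empty
    by (intro Max_in) auto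
  then show ?thesis using that by auto
qed

lemma indep_card_le_rank: "I \<subseteq> S \<Longrightarrow> indep I \<Longrightarrow> card I \<le> matroid_rank indep S"
  unfolding matroid_rank_def using finite_indep_subsets by (intro Max_ge) auto

lemma rank_ground: "matroid_basis indep B \<Longrightarrow> matroid_rank indep E = card B"
  by (metis rank_witness indep_card_le_rank indep_card_le_basis basis_indep basis_subset le_antisym)

lemma basis_containing_rank:
  obtains B where "matroid_basis indep B" "card (B \<inter> S) = matroid_rank indep S"
proof -
  obtain I where I: "I \<subseteq> S" "indep I" "card I = matroid_rank indep S" by (rule rank_witness)
  obtain C where C: "matroid_basis indep C" using basis_exists by blast
  obtain B where B: "indep B" "I \<subseteq> B" "card B = card C"
    using augment_within[OF I(2) basis_indep[OF C] indep_card_le_basis[OF C I(2)]] by blast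
  have "card I \<le> card (B \<inter> S)" using I B indep_finite by (intro card_mono) auto
  moreover have "card (B \<inter> S) \<le> matroid_rank indep S"
    using B indep_mono by (intro indep_card_le_rank) auto
  ultimately show ?thesis using that basis_if_card_eq[OF C B(1,3)] I by simp
qed

text \<open>Otherwise the exchange would enlarge \<open>B \<inter> S\<close> by \<open>b\<close>,
  giving an independent subset of \<open>S\<close> larger than its rank.\<close>

lemma exchange_card_Int:
  assumes B: "matroid_basis indep B" "card (B \<inter> S) = matroid_rank indep S"
    and ab: "a \<in> B" "b \<notin> B" "exchangeable indep B a b" and bS: "b \<in> S"
  shows "a \<in> S"
proof (rule ccontr)
  assume "a \<notin> S"
  then have eq: "insert b (B - {a}) \<inter> S = insert b (B \<inter> S)" using bS by auto
  have "indep (insert b (B - {a}))" using ab(3) by (simp add: exchangeable_def basis_indep)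
  then have "indep (insert b (B - {a}) \<inter> S)" by (rule indep_mono) simp
  then have "card (insert b (B - {a}) \<inter> S) \<le> matroid_rank indep S"
    by (intro indep_card_le_rank) simp
  then show False unfolding eq using B ab basis_finite by simp
qed

text \<open>The basis attached to \<open>S\<close> is a lightest basis of \<open>S\<close> together with a heaviest basis of the
  contraction of \<open>S\<close>.\<close>

lemma active_basis_exists:
  assumes inj: "inj_on key E" and S: "S \<subseteq> E"
  obtains B where "matroid_basis indep B" "card (B \<inter> S) = matroid_rank indep S"
    "B - S \<subseteq> int_active E indep key B" "S - B \<subseteq> ext_active E indep key B"
proof -
  \<comment> \<open>Flipping the sign outside \<open>S\<close> lets one minimisation prefer small
    keys in \<open>S\<close> and large keys outside. Swaps within \<open>S\<close> or within its
    complement keep \<open>card (B \<inter> S)\<close>, so they stay among the candidates.\<close>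
  define w where "w e = (if e \<in> S then int (key e) else - int (key e))" for e
  let ?F = "{B. matroid_basis indep B \<and> card (B \<inter> S) = matroid_rank indep S}"
  have "finite ?F" by (rule finite_subset[OF _ finite_bases]) auto
  moreover have "?F \<noteq> {}" using basis_containing_rank by blast
  ultimately obtain B where "is_arg_min (sum w) (\<lambda>B. B \<in> ?F) B"
    using ex_is_arg_min_if_finite by blast
  then have B: "matroid_basis indep B" "card (B \<inter> S) = matroid_rank indep S"
    and min: "\<And>C. C \<in> ?F \<Longrightarrow> sum w B \<le> sum w C"
    unfolding is_arg_min_linorder by auto
  have swap: "w a \<le> w b \<and> key a \<noteq> key b"
    if ab: "a \<in> B" "b \<in> E - B" "exchangeable indep B a b" "a \<in> S \<longleftrightarrow> b \<in> S" for a b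
  proof -
    let ?C = "insert b (B - {a})"
    have "card (?C \<inter> S) = card (B \<inter> S)"
    proof (cases "a \<in> S")
      case True
      then have "?C \<inter> S = insert b ((B \<inter> S) - {a})" using ab by auto
      moreover have "card (insert b ((B \<inter> S) - {a})) = card (B \<inter> S)"
        using True ab basis_finite[OF B(1)] by (intro card_insert_Diff_singleton) auto
      ultimately show ?thesis by simp
    next
      case False
      then have "?C \<inter> S = B \<inter> S" using ab by auto
      then show ?thesis by simp
    qed
    then have "sum w B \<le> sum w ?C" using ab B by (intro min) (simp add: exchangeable_def)
    moreover have "sum w ?C = w b + sum w (B - {a})"
      using ab basis_finite[OF B(1)] by simp
    moreover have "sum w B = w a + sum w (B - {a})"
      using ab basis_finite[OF B(1)] by (simp add: sum.remove)
    moreover have "key a \<noteq> key b" using inj ab basis_subset[OF B(1)] unfolding inj_on_def by blast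
    ultimately show ?thesis by simp
  qed
  have "B - S \<subseteq> int_active E indep key B"
    unfolding int_active_def
  proof safe
    fix a b assume a: "a \<in> B" "a \<notin> S" and b: "b \<in> E" "b \<notin> B" "exchangeable indep B a b"
    then have bS: "b \<notin> S" using exchange_card_Int[OF B] by blast
    then have "w a \<le> w b \<and> key a \<noteq> key b" using a b by (intro swap) auto
    then show "key b < key a" using a bS by (auto simp: w_def)
  qed
  moreover have "S - B \<subseteq> ext_active E indep key B"
    unfolding ext_active_def
  proof safe
    fix a b assume b: "b \<in> S" "b \<notin> B" and a: "a \<in> B" "exchangeable indep B a b"
    then have aS: "a \<in> S" using exchange_card_Int[OF B] by blast
    then have "w a \<le> w b \<and> key a \<noteq> key b" using a b S by (intro swap) auto
    then show "key a < key b" using aS b by (auto simp: w_def)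
  qed (use S in auto)
  ultimately show ?thesis using that B by blast
qed

text \<open>Let \<open>e\<close> have the largest key in the symmetric difference. Symmetric
  exchange gives an \<open>f\<close> in the other basis, adjacent to \<open>e\<close> in both
  exchange graphs. If \<open>f\<close> is in \<open>S\<close>, it is externally active for the basis
  of \<open>e\<close>, otherwise internally active for its own; either way its key exceeds that of
  \<open>e\<close>.\<close>

lemma active_basis_unique:
  assumes B: "matroid_basis indep B" "B - S \<subseteq> int_active E indep key B"
      "S - B \<subseteq> ext_active E indep key B"
    and C: "matroid_basis indep C" "C - S \<subseteq> int_active E indep key C"
      "S - C \<subseteq> ext_active E indep key C"
  shows "B = C"
proof (rule ccontr)
  assume "B \<noteq> C"
  let ?D = "(B - C) \<union> (C - B)"
  have fin: "finite ?D" and ne: "?D \<noteq> {}"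
    using basis_finite[OF B(1)] basis_finite[OF C(1)] \<open>B \<noteq> C\<close> by auto
  define m where "m = Max (key ` ?D)"
  have "m \<in> key ` ?D" unfolding m_def using fin ne by (intro Max_in) auto
  then obtain e where e: "e \<in> ?D" "m = key e" by blast
  have le: "key f \<le> key e" if "f \<in> ?D" for f
    using that fin e(2) unfolding m_def by (metis Max_ge finite_imageI imageI)
  have contra: False
    if B: "matroid_basis indep B" "S - B \<subseteq> ext_active E indep key B"
    and C: "matroid_basis indep C" "C - S \<subseteq> int_active E indep key C"
    and e: "e \<in> B - C" and le: "\<And>f. f \<in> C - B \<Longrightarrow> key f \<le> key e" for B C
  proof -
    obtain f where f: "f \<in> C - B" "exchangeable indep B e f" "exchangeable indep C f e"
      using symmetric_exchange[OF B(1) C(1) e] .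
    have "e \<in> E" using e basis_subset[OF B(1)] by blast
    then have "key e < key f"
      using f e B(2) C(2) unfolding ext_active_def int_active_def by blast
    then show False using le[OF f(1)] by simp
  qed
  show False
    using e(1) le contra[OF B(1,3) C(1,2)] contra[OF C(1,3) B(1,2)] by blast
qed

text \<open>Crapo's theorem: the intervals \<open>[B - int_active B, B \<union> ext_active B]\<close> partition the power
  set of \<open>E\<close>.\<close>

theorem tutte_activities:
  assumes inj: "inj_on key E"
  shows "tutte E indep x y = (\<Sum>B | matroid_basis indep B.
           x ^ card (int_active E indep key B) * y ^ card (ext_active E indep key B))"
proof -
  let ?IA = "int_active E indep key" and ?EA = "ext_active E indep key"
  \<comment> \<open>\<open>P S B\<close> says that \<open>S\<close> lies in the interval of
    \<open>B\<close>; \<open>\<tau> S\<close> is the one basis with this property.\<close>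
  define P where "P S B \<longleftrightarrow> matroid_basis indep B \<and> B - S \<subseteq> ?IA B \<and> S - B \<subseteq> ?EA B" for S B
  define \<tau> where "\<tau> S = (THE B. P S B)" for S
  have \<tau>: "P S (\<tau> S) \<and> card (\<tau> S \<inter> S) = matroid_rank indep S \<and> (\<forall>B. P S B \<longrightarrow> B = \<tau> S)"
    if S: "S \<subseteq> E" for S
  proof -
    obtain B where B: "P S B" "card (B \<inter> S) = matroid_rank indep S"
      using active_basis_exists[OF inj S] unfolding P_def by metis
    have uniq: "C = B" if "P S C" for C
      using active_basis_unique B(1) that unfolding P_def by blast
    have "\<tau> S = B" unfolding \<tau>_def using B(1) uniq by (rule the_equality)
    then show ?thesis using B uniq by blast
  qed
  define t where "t S = (x - 1) ^ card (\<tau> S - S) * (y - 1) ^ card (S - \<tau> S)" for S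
  have "tutte E indep x y = (\<Sum>S\<in>Pow E. t S)"
    unfolding tutte_def
  proof (rule sum.cong[OF refl])
    fix S assume "S \<in> Pow E"
    then have S: "S \<subseteq> E" "finite S" using finite_ground finite_subset by auto
    have b: "matroid_basis indep (\<tau> S)" and r: "matroid_rank indep S = card (\<tau> S \<inter> S)"
      using \<tau>[OF S(1)] unfolding P_def by auto
    \<comment> \<open>As \<open>\<tau> S\<close> meets \<open>S\<close> in exactly rank many
      elements, the two differences have the corank and the nullity of \<open>S\<close> as
      sizes.\<close>
    have "card (\<tau> S - S) = matroid_rank indep E - matroid_rank indep S"
      unfolding rank_ground[OF b] r using basis_finite[OF b] by (simp add: card_Diff_subset_Int)
    moreover have "card (S - \<tau> S) = card S - matroid_rank indep S"
      unfolding r using S by (simp add: card_Diff_subset_Int Int_commute)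
    ultimately show "(x - 1) ^ (matroid_rank indep E - matroid_rank indep S) *
        (y - 1) ^ (card S - matroid_rank indep S) = t S" by (simp add: t_def)
  qed
  also have "\<dots> = (\<Sum>B | matroid_basis indep B. \<Sum>S\<in>{S \<in> Pow E. \<tau> S = B}. t S)"
    using finite_ground finite_bases \<tau> unfolding P_def by (intro sum.group[symmetric]) auto
  also have "\<dots> = (\<Sum>B | matroid_basis indep B. x ^ card (?IA B) * y ^ card (?EA B))"
  proof (rule sum.cong[OF refl])
    fix B assume "B \<in> {B. matroid_basis indep B}"
    then have B: "matroid_basis indep B" by simp
    have sub: "?IA B \<subseteq> B" "?EA B \<subseteq> E - B" "B \<subseteq> E"
      using basis_subset[OF B] by (auto simp: int_active_def ext_active_def)
    have fin: "finite (?IA B)" "finite (?EA B)"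
      using sub finite_ground by (meson finite_subset finite_Diff)+
    \<comment> \<open>A member of the interval is determined by the active elements removed and
      added. So the sum factors, and the binomial theorem turns \<open>x - 1\<close> and
      \<open>y - 1\<close> into \<open>x\<close> and \<open>y\<close>.\<close>
    have "(\<Sum>S\<in>{S \<in> Pow E. \<tau> S = B}. t S)
        = (\<Sum>(X, Y)\<in>Pow (?IA B) \<times> Pow (?EA B). (x - 1) ^ card X * (y - 1) ^ card Y)"
    proof (rule sum.reindex_bij_witness[of _ "\<lambda>(X, Y). (B - X) \<union> Y" "\<lambda>S. (B - S, S - B)"])
      fix S assume S: "S \<in> {S \<in> Pow E. \<tau> S = B}"
      then have "P S B" using \<tau> by auto
      then show "(B - S, S - B) \<in> Pow (?IA B) \<times> Pow (?EA B)" unfolding P_def by auto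
      show "(case (B - S, S - B) of (X, Y) \<Rightarrow> (B - X) \<union> Y) = S" by auto
      show "(case (B - S, S - B) of (X, Y) \<Rightarrow> (x - 1) ^ card X * (y - 1) ^ card Y) = t S"
        using S by (auto simp: t_def)
    next
      fix Z assume "Z \<in> Pow (?IA B) \<times> Pow (?EA B)"
      then obtain X Y where Z: "Z = (X, Y)" "X \<subseteq> ?IA B" "Y \<subseteq> ?EA B" by auto
      let ?S = "(B - X) \<union> Y"
      have eq: "B - ?S = X" "?S - B = Y" using Z sub by auto
      then show "(B - (case Z of (X, Y) \<Rightarrow> (B - X) \<union> Y), (case Z of (X, Y) \<Rightarrow> (B - X) \<union> Y) - B) = Z"
        using Z by auto
      have "P ?S B" unfolding P_def eq using B Z by auto
      moreover have "?S \<subseteq> E" using Z sub by auto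
      ultimately show "(case Z of (X, Y) \<Rightarrow> (B - X) \<union> Y) \<in> {S \<in> Pow E. \<tau> S = B}"
        using \<tau> Z by auto
    qed
    also have "\<dots> = (\<Sum>X\<in>Pow (?IA B). (x - 1) ^ card X) * (\<Sum>Y\<in>Pow (?EA B). (y - 1) ^ card Y)"
      by (simp add: sum_product sum.cartesian_product)
    also have "\<dots> = x ^ card (?IA B) * y ^ card (?EA B)"
      using fin by (simp add: sum_Pow_power_card)
    finally show "(\<Sum>S\<in>{S \<in> Pow E. \<tau> S = B}. t S) = x ^ card (?IA B) * y ^ card (?EA B)" .
  qed
  finally show ?thesis .
qed

section \<open>Neighbourhoods in the exchange graph as fundamental circuits and cocircuits\<close>

lemma fundamental_circuit:
  assumes B: "matroid_basis indep B" and b: "b \<in> E - B"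
  shows "matroid_circuit E indep (insert b {a \<in> B. exchangeable indep B a b})"
proof -
  have "b \<notin> B" using b by simp
  then obtain X where X: "X \<subseteq> B" "\<not> indep (insert b X)" "\<And>Y. Y \<subset> X \<Longrightarrow> indep (insert b Y)"
    "\<And>f. f \<in> X \<Longrightarrow> matroid_basis indep (insert b (B - {f}))"
    using minimal_spanning_subset[OF B] by metis
  \<comment> \<open>Removing an \<open>a\<close> outside \<open>X\<close> leaves the dependent set
    \<open>insert b X\<close> inside \<open>insert b (B - {a})\<close>, so only members of
    \<open>X\<close> can be exchanged.\<close>
  have "{a \<in> B. exchangeable indep B a b} = X"
  proof (rule set_eqI, rule iffI)
    fix a assume a: "a \<in> {a \<in> B. exchangeable indep B a b}"
    show "a \<in> X"
    proof (rule ccontr)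
      assume "a \<notin> X"
      then have "insert b X \<subseteq> insert b (B - {a})" using X(1) by blast
      then show False using a X(2) indep_mono basis_indep unfolding exchangeable_def by blast
    qed
  qed (use X in \<open>auto simp: exchangeable_def\<close>)
  moreover have "indep Z" if Z: "Z \<subset> insert b X" for Z
  proof (cases "b \<in> Z")
    case True
    then have "Z - {b} \<subset> X" using Z by blast
    then show ?thesis using X(3)[of "Z - {b}"] True by (simp add: insert_absorb)
  next
    case False
    then have "Z \<subseteq> B" using Z X(1) by blast
    then show ?thesis using indep_mono[OF basis_indep[OF B]] by blast
  qed
  ultimately show ?thesis
    using X b basis_subset[OF B] unfolding matroid_circuit_def by auto
qed

text \<open>Complementation maps \<open>insert b (B - {a})\<close> to
  \<open>insert a (E - B - {b})\<close>, so the dual has the same exchange graph with the sides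
  swapped.\<close>

lemma dual_exchangeable_iff:
  assumes B: "matroid_basis indep B" and a: "a \<in> B" and b: "b \<in> E - B"
  shows "exchangeable (dual_indep E indep) (E - B) b a \<longleftrightarrow> exchangeable indep B a b"
proof -
  have sub: "B \<subseteq> E" by (rule basis_subset[OF B])
  have eq: "insert a (E - B - {b}) = E - insert b (B - {a})" using a b sub by auto
  have "C = insert b (B - {a})" if "matroid_basis indep C" "insert a (E - B - {b}) = E - C" for C
  proof -
    have "E - C = E - insert b (B - {a})" using that eq by simp
    moreover have "C \<subseteq> E" "insert b (B - {a}) \<subseteq> E" using basis_subset that sub b by auto
    ultimately show ?thesis by blast
  qed
  then show ?thesis unfolding exchangeable_def dual_basis_iff using eq by blast
qed

lemma fundamental_cocircuit:
  assumes B: "matroid_basis indep B" and a: "a \<in> B"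
  shows "matroid_circuit E (dual_indep E indep) (insert a {b \<in> E - B. exchangeable indep B a b})"
proof -
  interpret dual: matroid E "dual_indep E indep" by (rule dual_matroid)
  have "matroid_basis (dual_indep E indep) (E - B)" using dual_basis_iff B by blast
  moreover have "a \<in> E - (E - B)" using a basis_subset[OF B] by blast
  ultimately have "matroid_circuit E (dual_indep E indep)
      (insert a {b \<in> E - B. exchangeable (dual_indep E indep) (E - B) b a})"
    by (rule dual.fundamental_circuit)
  moreover have "{b \<in> E - B. exchangeable (dual_indep E indep) (E - B) b a}
      = {b \<in> E - B. exchangeable indep B a b}"
    using dual_exchangeable_iff[OF B a] by blast
  ultimately show ?thesis by simp
qed

end

subsection \<open>Harris' inequality\<close>

lemma sum_PiE_insert:
  fixes F :: "('a \<Rightarrow> 'b) \<Rightarrow> real"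
  assumes "i \<notin> I"
  shows "(\<Sum>f\<in>PiE (insert i I) V. F f) = (\<Sum>v\<in>V i. \<Sum>f\<in>PiE I V. F (f(i := v)))"
proof -
  have "(\<Sum>f\<in>PiE (insert i I) V. F f) = (\<Sum>p\<in>V i \<times> PiE I V. F ((snd p)(i := fst p)))"
    unfolding PiE_insert_eq using inj_combinator[OF assms, of V]
    by (subst sum.reindex) (auto simp: case_prod_beta' o_def intro!: sum.cong)
  then show ?thesis by (simp add: sum.cartesian_product case_prod_beta)
qed

lemma sum_PiE_prod:
  fixes h :: "'a \<Rightarrow> 'b \<Rightarrow> real"
  assumes "finite I"
  shows "(\<Sum>f\<in>PiE I V. \<Prod>i\<in>I. h i (f i)) = (\<Prod>i\<in>I. \<Sum>v\<in>V i. h i v)"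
  using assms
proof (induction I rule: finite_induct)
  case (insert i I)
  have "(\<Sum>f\<in>PiE (insert i I) V. \<Prod>j\<in>insert i I. h j (f j))
      = (\<Sum>v\<in>V i. \<Sum>f\<in>PiE I V. h i v * (\<Prod>j\<in>I. h j (f j)))"
    unfolding sum_PiE_insert[OF insert(2)]
  proof (intro sum.cong refl)
    fix v f
    have "(\<Prod>j\<in>I. h j ((f(i := v)) j)) = (\<Prod>j\<in>I. h j (f j))"
      using insert by (intro prod.cong) auto
    then show "(\<Prod>j\<in>insert i I. h j ((f(i := v)) j)) = h i v * (\<Prod>j\<in>I. h j (f j))"
      using insert by simp
  qed
  then show ?case using insert by (simp flip: sum_distrib_left sum_distrib_right)
qed simp

lemma sum_PiE_Un:
  fixes F :: "('a \<Rightarrow> 'b) \<Rightarrow> real"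
  assumes "A \<inter> B = {}"
  shows "(\<Sum>f\<in>PiE (A \<union> B) V. F f)
       = (\<Sum>x\<in>PiE A V. \<Sum>y\<in>PiE B V. F (\<lambda>v. if v \<in> A then x v else y v))"
  unfolding sum.cartesian_product
proof (rule sum.reindex_bij_witness[of _ "\<lambda>(x, y) v. if v \<in> A then x v else y v"
      "\<lambda>f. (restrict f A, restrict f B)"])
  fix p assume "p \<in> PiE A V \<times> PiE B V"
  then obtain x y where p: "p = (x, y)" "x \<in> PiE A V" "y \<in> PiE B V" by auto
  show "(restrict (case p of (x, y) \<Rightarrow> \<lambda>v. if v \<in> A then x v else y v) A,
      restrict (case p of (x, y) \<Rightarrow> \<lambda>v. if v \<in> A then x v else y v) B) = p"
    using p assms by (auto simp: fun_eq_iff restrict_def PiE_def extensional_def)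
  show "(case p of (x, y) \<Rightarrow> \<lambda>v. if v \<in> A then x v else y v) \<in> PiE (A \<union> B) V"
    using p by (auto simp: PiE_def extensional_def Pi_def)
next
  fix f assume f: "f \<in> PiE (A \<union> B) V"
  show eq: "(case (restrict f A, restrict f B) of (x, y) \<Rightarrow> \<lambda>v. if v \<in> A then x v else y v) = f"
    using f by (auto simp: fun_eq_iff restrict_def PiE_def extensional_def)
  show "(restrict f A, restrict f B) \<in> PiE A V \<times> PiE B V"
    using f by auto
  show "(case (restrict f A, restrict f B) of (x, y) \<Rightarrow> F (\<lambda>v. if v \<in> A then x v else y v)) = F f"
    using eq by auto
qed

text \<open>The double sum of \<open>p u * p v * ((f u - f v) * (g u - g v))\<close> has nonnegative
  terms and equals twice the covariance.\<close>

lemma chebyshev_sum_weighted: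
  fixes p f g :: "'b \<Rightarrow> real"
  assumes p: "\<And>v. v \<in> V \<Longrightarrow> 0 \<le> p v" "sum p V = 1"
    and co: "\<And>u v. u \<in> V \<Longrightarrow> v \<in> V \<Longrightarrow> 0 \<le> (f u - f v) * (g u - g v)"
  shows "(\<Sum>v\<in>V. p v * f v) * (\<Sum>v\<in>V. p v * g v) \<le> (\<Sum>v\<in>V. p v * (f v * g v))"
proof -
  have "0 \<le> (\<Sum>u\<in>V. \<Sum>v\<in>V. p u * p v * ((f u - f v) * (g u - g v)))"
    using p co by (intro sum_nonneg mult_nonneg_nonneg[OF mult_nonneg_nonneg]) auto
  also have "\<dots> = (\<Sum>u\<in>V. \<Sum>v\<in>V. p u * (f u * g u) * p v) + (\<Sum>u\<in>V. \<Sum>v\<in>V. p u * (p v * (f v * g v)))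
      - (\<Sum>u\<in>V. \<Sum>v\<in>V. (p u * f u) * (p v * g v)) - (\<Sum>u\<in>V. \<Sum>v\<in>V. (p u * g u) * (p v * f v))"
    by (simp add: algebra_simps sum.distrib sum_subtractf)
  also have "\<dots> = 2 * ((\<Sum>v\<in>V. p v * (f v * g v)) - (\<Sum>v\<in>V. p v * f v) * (\<Sum>v\<in>V. p v * g v))"
    using p(2) by (simp flip: sum_product sum_distrib_left sum_distrib_right)
  finally show ?thesis by simp
qed

section \<open>Expectations of independent labels\<close>

definition prod_expect ::
  "('a \<Rightarrow> 'b set) \<Rightarrow> ('a \<Rightarrow> 'b \<Rightarrow> real) \<Rightarrow> 'a set \<Rightarrow> (('a \<Rightarrow> 'b) \<Rightarrow> real) \<Rightarrow> real" where
  "prod_expect V p I F = (\<Sum>f\<in>PiE I V. (\<Prod>i\<in>I. p i (f i)) * F f)"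

text \<open>The order is a parameter so that one inequality covers increasing functions
  (\<open>\<le>\<close>) and decreasing ones (\<open>\<ge>\<close>).\<close>

definition mono_labels ::
  "('b \<Rightarrow> 'b \<Rightarrow> bool) \<Rightarrow> ('a \<Rightarrow> 'b set) \<Rightarrow> 'a set \<Rightarrow> (('a \<Rightarrow> 'b) \<Rightarrow> real) \<Rightarrow> bool" where
  "mono_labels le V I F \<longleftrightarrow>
     (\<forall>f\<in>PiE I V. \<forall>g\<in>PiE I V. (\<forall>i\<in>I. le (f i) (g i)) \<longrightarrow> F f \<le> F g)"

lemma mono_labelsD:
  "mono_labels le V I F \<Longrightarrow> f \<in> PiE I V \<Longrightarrow> g \<in> PiE I V \<Longrightarrow> (\<And>i. i \<in> I \<Longrightarrow> le (f i) (g i)) \<Longrightarrow> F f \<le> F g"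
  unfolding mono_labels_def by blast

lemma prod_expect_insert:
  assumes "finite I" "i \<notin> I"
  shows "prod_expect V p (insert i I) F
       = (\<Sum>v\<in>V i. p i v * prod_expect V p I (\<lambda>f. F (f(i := v))))"
  unfolding prod_expect_def sum_PiE_insert[OF assms(2)] sum_distrib_left
proof (intro sum.cong refl)
  fix v f
  have "(\<Prod>j\<in>I. p j ((f(i := v)) j)) = (\<Prod>j\<in>I. p j (f j))"
    using assms by (intro prod.cong) auto
  then show "(\<Prod>j\<in>insert i I. p j ((f(i := v)) j)) * F (f(i := v))
      = p i v * ((\<Prod>j\<in>I. p j (f j)) * F (f(i := v)))"
    using assms by simp
qed

lemma prod_expect_mono:
  assumes "\<And>i v. i \<in> I \<Longrightarrow> v \<in> V i \<Longrightarrow> 0 \<le> p i v"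
    and "\<And>f. f \<in> PiE I V \<Longrightarrow> F f \<le> G f"
  shows "prod_expect V p I F \<le> prod_expect V p I G"
  unfolding prod_expect_def
  using assms by (intro sum_mono mult_left_mono prod_nonneg) auto

lemma prod_expect_prod:
  fixes h :: "'a \<Rightarrow> 'b \<Rightarrow> real"
  assumes "finite I" "J \<subseteq> I" and p1: "\<And>i. i \<in> I \<Longrightarrow> sum (p i) (V i) = 1"
  shows "prod_expect V p I (\<lambda>f. \<Prod>j\<in>J. h j (f j)) = (\<Prod>j\<in>J. \<Sum>v\<in>V j. p j v * h j v)"
proof -
  let ?h = "\<lambda>i v. p i v * (if i \<in> J then h i v else 1)"
  have "(\<Prod>i\<in>I. p i (f i)) * (\<Prod>j\<in>J. h j (f j)) = (\<Prod>i\<in>I. ?h i (f i))" for f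
  proof -
    have "(\<Prod>j\<in>J. h j (f j)) = (\<Prod>i\<in>I. if i \<in> J then h i (f i) else 1)"
      using assms by (simp add: prod.If_cases Int_absorb1)
    then show ?thesis by (simp add: prod.distrib)
  qed
  then have "prod_expect V p I (\<lambda>f. \<Prod>j\<in>J. h j (f j)) = (\<Prod>i\<in>I. \<Sum>v\<in>V i. ?h i v)"
    unfolding prod_expect_def using sum_PiE_prod[OF assms(1), of ?h V] by simp
  also have "\<dots> = (\<Prod>i\<in>I. if i \<in> J then \<Sum>v\<in>V i. p i v * h i v else 1)"
    using p1 by (intro prod.cong) auto
  also have "\<dots> = (\<Prod>j\<in>J. \<Sum>v\<in>V j. p j v * h j v)"
    using assms by (simp add: prod.If_cases Int_absorb1)
  finally show ?thesis .
qed

lemma prod_expect_one: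
  assumes "finite I" "\<And>i. i \<in> I \<Longrightarrow> sum (p i) (V i) = 1"
  shows "prod_expect V p I (\<lambda>_. c) = c"
  using sum_PiE_prod[OF assms(1), of p V] assms
  by (simp add: prod_expect_def flip: sum_distrib_right)

text \<open>Induction on the coordinates: after conditioning on the label of \<open>i\<close>,
  Chebyshev correlates the conditional expectations, which are monotone in that label, and the
  induction hypothesis correlates \<open>F\<close> and \<open>G\<close> for each fixed
  label.\<close>

theorem harris:
  assumes "finite I"
    and p: "\<And>i v. i \<in> I \<Longrightarrow> v \<in> V i \<Longrightarrow> 0 \<le> p i v" "\<And>i. i \<in> I \<Longrightarrow> sum (p i) (V i) = 1"
    and le: "\<And>u v. le u v \<or> le v u"
    and "mono_labels le V I F" "mono_labels le V I G"
  shows "prod_expect V p I F * prod_expect V p I G \<le> prod_expect V p I (\<lambda>f. F f * G f)"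
  using assms(1,2,3,5,6)
proof (induction I arbitrary: F G rule: finite_induct)
  case empty
  then show ?case by (simp add: prod_expect_def)
next
  case (insert i I)
  have refl: "le v v" for v using le by blast
  have upd: "f(i := v) \<in> PiE (insert i I) V" if "f \<in> PiE I V" "v \<in> V i" for f v
    using that insert(2) by (auto simp: PiE_def extensional_def)
  have sect: "mono_labels le V I (\<lambda>f. H (f(i := v)))"
    if "v \<in> V i" "mono_labels le V (insert i I) H" for v H
    unfolding mono_labels_def
  proof (intro ballI impI)
    fix f g assume fg: "f \<in> PiE I V" "g \<in> PiE I V" "\<forall>j\<in>I. le (f j) (g j)"
    show "H (f(i := v)) \<le> H (g(i := v))"
      by (rule mono_labelsD[OF that(2)]) (use fg upd that refl in auto)
  qed
  define EF where "EF H v = prod_expect V p I (\<lambda>f. H (f(i := v)))" for H v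
  have EF_mono: "EF H u \<le> EF H v"
    if "u \<in> V i" "v \<in> V i" "le u v" "mono_labels le V (insert i I) H" for H u v
    unfolding EF_def
  proof (rule prod_expect_mono)
    fix f assume f: "f \<in> PiE I V"
    show "H (f(i := u)) \<le> H (f(i := v))"
      by (rule mono_labelsD[OF that(4)]) (use f upd that refl in auto)
  qed (use insert in auto)
  have "prod_expect V p (insert i I) F * prod_expect V p (insert i I) G
      = (\<Sum>v\<in>V i. p i v * EF F v) * (\<Sum>v\<in>V i. p i v * EF G v)"
    unfolding prod_expect_insert[OF insert(1,2)] EF_def ..
  also have "\<dots> \<le> (\<Sum>v\<in>V i. p i v * (EF F v * EF G v))"
  proof (rule chebyshev_sum_weighted)
    fix u v assume uv: "u \<in> V i" "v \<in> V i"
    consider "le u v" | "le v u" using le by blast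
    then show "0 \<le> (EF F u - EF F v) * (EF G u - EF G v)"
      using EF_mono[OF uv] EF_mono[OF uv(2,1)] insert.prems(3,4)
      by cases (auto intro!: mult_nonneg_nonneg mult_nonpos_nonpos)
  qed (use insert in auto)
  also have "\<dots> \<le> (\<Sum>v\<in>V i. p i v * EF (\<lambda>f. F f * G f) v)"
    unfolding EF_def
    using insert.prems insert.IH sect by (intro sum_mono mult_left_mono) auto
  also have "\<dots> = prod_expect V p (insert i I) (\<lambda>f. F f * G f)"
    unfolding prod_expect_insert[OF insert(1,2)] EF_def ..
  finally show ?case .
qed

text \<open>Nonnegativity keeps products of monotone functions monotone, so Harris' inequality
  applies factor by factor.\<close>

corollary harris_prod:
  assumes I: "finite I"
    and p: "\<And>i v. i \<in> I \<Longrightarrow> v \<in> V i \<Longrightarrow> 0 \<le> p i v" "\<And>i. i \<in> I \<Longrightarrow> sum (p i) (V i) = 1"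
    and le: "\<And>u v. le u v \<or> le v u"
    and K: "finite K"
    and mono: "\<And>k. k \<in> K \<Longrightarrow> mono_labels le V I (F k)"
    and nonneg: "\<And>k f. k \<in> K \<Longrightarrow> f \<in> PiE I V \<Longrightarrow> 0 \<le> F k f"
  shows "(\<Prod>k\<in>K. prod_expect V p I (F k)) \<le> prod_expect V p I (\<lambda>f. \<Prod>k\<in>K. F k f)"
  using K mono nonneg
proof (induction K rule: finite_induct)
  case empty
  then show ?case using prod_expect_one[where p = p and V = V and c = 1] I p by simp
next
  case (insert k K)
  have pos: "0 \<le> prod_expect V p I (F k)"
    unfolding prod_expect_def
  proof (intro sum_nonneg mult_nonneg_nonneg prod_nonneg)
    fix f i assume "f \<in> PiE I V" "i \<in> I"
    then show "0 \<le> p i (f i)" using p(1) PiE_mem by metis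
  qed (use insert.prems(2) in auto)
  have mono: "mono_labels le V I (\<lambda>f. \<Prod>k\<in>K. F k f)"
    unfolding mono_labels_def
  proof (intro ballI impI prod_mono conjI)
    fix f g j assume fg: "f \<in> PiE I V" "g \<in> PiE I V" "\<forall>i\<in>I. le (f i) (g i)" "j \<in> K"
    then show "F j f \<le> F j g" using insert.prems(1)[of j] by (auto intro: mono_labelsD)
    show "0 \<le> F j f" using insert.prems(2)[of j] fg by auto
  qed
  have "(\<Prod>k\<in>insert k K. prod_expect V p I (F k))
      \<le> prod_expect V p I (F k) * prod_expect V p I (\<lambda>f. \<Prod>k\<in>K. F k f)"
    using insert.IH insert.prems insert.hyps pos by (simp add: mult_left_mono)
  also have "\<dots> \<le> prod_expect V p I (\<lambda>f. F k f * (\<Prod>k\<in>K. F k f))"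
    using insert.prems by (intro harris[OF I p le _ mono]) auto
  also have "\<dots> = prod_expect V p I (\<lambda>f. \<Prod>k\<in>insert k K. F k f)"
    using insert by simp
  finally show ?case .
qed

subsection \<open>Random labels of a bipartite graph\<close>

lemma prod_expect_affine:
  assumes "finite I" "\<And>i. i \<in> I \<Longrightarrow> sum (p i) (V i) = 1"
  shows "prod_expect V p I (\<lambda>f. c + k * F f) = c + k * prod_expect V p I F"
proof -
  have "prod_expect V p I (\<lambda>f. c + k * F f)
      = prod_expect V p I (\<lambda>_. c) + k * prod_expect V p I F"
    unfolding prod_expect_def by (simp add: algebra_simps sum.distrib sum_distrib_left)
  then show ?thesis using prod_expect_one[where p = p and V = V and c = c] assms by simp
qed

lemma prod_expect_sum:
  "prod_expect V p I (\<lambda>f. \<Sum>k\<in>K. F k f) = (\<Sum>k\<in>K. prod_expect V p I (F k))"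
  unfolding prod_expect_def by (subst sum.swap) (simp add: sum_distrib_left)

lemma of_bool_Ball_eq_prod:
  assumes "finite J"
  shows "of_bool (\<forall>j\<in>J. P j) = (\<Prod>j\<in>J. of_bool (P j) :: real)"
  using assms by (induction J rule: finite_induct) auto

lemma sum_of_bool_lessThan:
  "(\<Sum>v<n. of_bool (v < m)) = real (min m n)" "(\<Sum>v<n. of_bool (v \<le> m)) = real (min (Suc m) n)"
proof -
  have "{..<n} \<inter> {v. v < m} = {..<min m n}" "{..<n} \<inter> {v. v \<le> m} = {..<min (Suc m) n}" by auto
  then show "(\<Sum>v<n. of_bool (v < m)) = real (min m n)" "(\<Sum>v<n. of_bool (v \<le> m)) = real (min (Suc m) n)"
    by (simp_all add: of_bool_def sum.If_cases)
qed

text \<open>With the labels \<open>x\<close> on \<open>A\<close> fixed, the factors \<open>g b\<close> depend on one label each, so they are absorbed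
  into the product measure before Harris' inequality is applied. Labels \<open>y \<ge> T\<close> get double weight,
  which makes it harder for the vertices of \<open>A\<close> to be active.\<close>

lemma harris_conditional:
  fixes R :: "'a \<Rightarrow> 'a \<Rightarrow> bool" and x :: "'a \<Rightarrow> nat"
  assumes fin: "finite A" "finite B" and T: "T \<le> N" "0 < N"
    and x: "\<And>a. a \<in> A \<Longrightarrow> x a < T"
  defines "g \<equiv> \<lambda>b y. 1 + of_bool (\<forall>a\<in>A. R a b \<longrightarrow> x a < y) :: real"
  shows "(\<Prod>a\<in>A. 1 - (real (Suc (x a)) / real (2 * N - T)) ^ card {b \<in> B. R a b}) * (\<Prod>b\<in>B. \<Sum>y<N. g b y)
       \<le> (\<Sum>y\<in>PiE B (\<lambda>_. {..<N}). (\<Prod>a\<in>A. of_bool (\<exists>b\<in>B. R a b \<and> x a < y b)) * (\<Prod>b\<in>B. g b (y b)))"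
proof -
  define Z where "Z b = (\<Sum>y<N. g b y)" for b
  define p where "p b y = g b y / Z b" for b y
  let ?V = "\<lambda>_::'a. {..<N}"
  let ?f = "\<lambda>a y. of_bool (\<exists>b\<in>B. R a b \<and> x a < y b) :: real"
  have g_ge: "1 \<le> g b y" for b y by (simp add: g_def)
  have g_ge': "1 + of_bool (\<not> y < T) \<le> g b y" for b y
    using x by (force simp: g_def)
  \<comment> \<open>Every \<open>x a\<close> is below \<open>T\<close>, so the \<open>N - T\<close>
    labels from \<open>T\<close> on have weight 2 and the others at least 1.\<close>
  have Z_ge: "real (2 * N - T) \<le> Z b" for b
  proof -
    have "(\<Sum>y<N. 1 + of_bool (\<not> y < T)) = (\<Sum>y<N. 2 - of_bool (y < T) :: real)"
      by (intro sum.cong) auto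
    also have "\<dots> = real (2 * N - T)"
      using T by (simp add: sum_subtractf sum_of_bool_lessThan of_nat_diff)
    finally show ?thesis unfolding Z_def using sum_mono[of "{..<N}" "\<lambda>y. 1 + of_bool (\<not> y < T)" "g b", OF g_ge']
      by simp
  qed
  have pos: "0 < real (2 * N - T)" using T by simp
  have Z_pos: "0 < Z b" for b using Z_ge[of b] pos by linarith
  have p_nonneg: "0 \<le> p b y" for b y
    unfolding p_def using g_ge[of b y] Z_pos[of b] by (intro divide_nonneg_pos) linarith+
  have p_sum: "sum (p b) {..<N} = 1" for b
    unfolding p_def using Z_pos[of b] by (simp add: Z_def flip: sum_divide_distrib)
  have E: "1 - (real (Suc (x a)) / real (2 * N - T)) ^ card {b \<in> B. R a b} \<le> prod_expect ?V p B (?f a)"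
    if a: "a \<in> A" for a
  proof -
    let ?J = "{b \<in> B. R a b}"
    have finJ: "finite ?J" using fin by simp
    \<comment> \<open>The complementary event, all neighbours of \<open>a\<close> labelled at most
      \<open>x a\<close>, is a product over independent labels.\<close>
    have "?f a y = 1 + (- 1) * (\<Prod>b\<in>?J. of_bool (y b \<le> x a))" for y
      unfolding of_bool_Ball_eq_prod[OF finJ, symmetric] by (auto simp: not_less)
    then have 1: "prod_expect ?V p B (?f a)
        = 1 - prod_expect ?V p B (\<lambda>y. \<Prod>b\<in>?J. of_bool (y b \<le> x a))"
      using prod_expect_affine[OF fin(2), of p ?V 1 "-1"] p_sum by simp
    have "prod_expect ?V p B (\<lambda>y. \<Prod>b\<in>?J. of_bool (y b \<le> x a))
        = (\<Prod>b\<in>?J. \<Sum>y<N. p b y * of_bool (y \<le> x a))"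
      using p_sum fin by (intro prod_expect_prod) auto
    also have "\<dots> \<le> (\<Prod>b\<in>?J. real (Suc (x a)) / real (2 * N - T))"
    proof (intro prod_mono conjI sum_nonneg mult_nonneg_nonneg p_nonneg)
      fix b assume b: "b \<in> ?J"
      \<comment> \<open>For a neighbour \<open>b\<close> of \<open>a\<close>, a label
        \<open>y \<le> x a\<close> makes \<open>b\<close> inactive, so its weight is exactly 1;
        there are \<open>Suc (x a)\<close> such labels.\<close>
      have "(\<Sum>y<N. p b y * of_bool (y \<le> x a)) = (\<Sum>y<N. of_bool (y \<le> x a) / Z b)"
        using a b by (intro sum.cong) (auto simp: p_def g_def)
      also have "\<dots> = real (Suc (x a)) / Z b"
        using x[OF a] T unfolding sum_divide_distrib[symmetric] sum_of_bool_lessThan by simp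
      also have "\<dots> \<le> real (Suc (x a)) / real (2 * N - T)"
        using Z_ge[of b] pos by (intro divide_left_mono) (auto intro: mult_pos_pos)
      finally show "(\<Sum>y<N. p b y * of_bool (y \<le> x a)) \<le> real (Suc (x a)) / real (2 * N - T)" .
    qed auto
    finally show ?thesis unfolding 1 by simp
  qed
  have le1: "real (Suc (x a)) / real (2 * N - T) \<le> 1" if "a \<in> A" for a
    using x[OF that] T by simp
  have "(\<Prod>a\<in>A. 1 - (real (Suc (x a)) / real (2 * N - T)) ^ card {b \<in> B. R a b})
      \<le> (\<Prod>a\<in>A. prod_expect ?V p B (?f a))"
    using E le1 by (intro prod_mono conjI) (auto intro!: power_le_one)
  also have "\<dots> \<le> prod_expect ?V p B (\<lambda>y. \<Prod>a\<in>A. ?f a y)"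
  proof (rule harris_prod[where le = "(\<le>)"])
    fix a show "mono_labels (\<le>) ?V B (?f a)"
      unfolding mono_labels_def
    proof (intro ballI impI)
      fix f h :: "'a \<Rightarrow> nat" assume "\<forall>b\<in>B. f b \<le> h b"
      then have "(\<exists>b\<in>B. R a b \<and> x a < f b) \<longrightarrow> (\<exists>b\<in>B. R a b \<and> x a < h b)"
        using less_le_trans by blast
      then show "?f a f \<le> ?f a h" by simp
    qed
  qed (use fin p_nonneg p_sum in auto)
  finally have "(\<Prod>a\<in>A. 1 - (real (Suc (x a)) / real (2 * N - T)) ^ card {b \<in> B. R a b}) * (\<Prod>b\<in>B. Z b)
      \<le> prod_expect ?V p B (\<lambda>y. \<Prod>a\<in>A. ?f a y) * (\<Prod>b\<in>B. Z b)"
    using Z_pos by (intro mult_right_mono prod_nonneg) (auto intro: less_imp_le)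
  also have "\<dots> = (\<Sum>y\<in>PiE B ?V. (\<Prod>a\<in>A. ?f a y) * (\<Prod>b\<in>B. g b (y b)))"
  proof -
    have "(\<Prod>b\<in>B. p b (y b)) * (\<Prod>b\<in>B. Z b) = (\<Prod>b\<in>B. g b (y b))" for y
      unfolding prod.distrib[symmetric] p_def using Z_pos by (intro prod.cong) (auto simp: less_le)
    then have "(\<Prod>b\<in>B. p b (y b)) * c * (\<Prod>b\<in>B. Z b) = c * (\<Prod>b\<in>B. g b (y b))" for y c
      by (simp only: mult.commute[of _ c] mult.assoc)
    then show ?thesis unfolding prod_expect_def sum_distrib_right by (simp only:)
  qed
  finally show ?thesis unfolding Z_def .
qed

text \<open>Labelings in which some vertex of \<open>A\<close> has a label at least \<open>T\<close> are discarded. This costs a factor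
  \<open>T / N\<close> per vertex of \<open>A\<close>, and every vertex of \<open>B\<close> gains a factor of about \<open>2 - T / N\<close>.\<close>

theorem label_sum_lower_bound:
  fixes R :: "'a \<Rightarrow> 'a \<Rightarrow> bool" and N T :: nat
  assumes fin: "finite A" "finite B" and disj: "A \<inter> B = {}" and T: "0 < T" "T \<le> N"
  shows "(\<Prod>a\<in>A. \<Sum>x<T. 1 - (real (Suc x) / real (2 * N - T)) ^ card {b \<in> B. R a b})
       * (\<Prod>b\<in>B. \<Sum>y<N. 1 + (real (min y T) / real T) ^ card {a \<in> A. R a b})
       \<le> (\<Sum>f\<in>PiE (A \<union> B) (\<lambda>_. {..<N}). (\<Prod>a\<in>A. of_bool (\<exists>b\<in>B. R a b \<and> f a < f b))
            * (\<Prod>b\<in>B. 1 + of_bool (\<forall>a\<in>A. R a b \<longrightarrow> f a < f b)))"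
proof -
  let ?W = "\<lambda>_::'a. {..<T}" and ?p = "\<lambda>_ _. 1 / real T"
  define h where "h a v = 1 - (real (Suc v) / real (2 * N - T)) ^ card {b \<in> B. R a b}" for a v
  define Z where "Z b x = (\<Sum>y<N. 1 + of_bool (\<forall>a\<in>A. R a b \<longrightarrow> x a < y) :: real)" for b and x :: "'a \<Rightarrow> nat"
  define G where "G x = (\<Sum>y\<in>PiE B (\<lambda>_. {..<N}). (\<Prod>a\<in>A. of_bool (\<exists>b\<in>B. R a b \<and> x a < y b))
      * (\<Prod>b\<in>B. 1 + of_bool (\<forall>a\<in>A. R a b \<longrightarrow> x a < y b)) :: real)" for x
  \<comment> \<open>One family over the disjoint union, so that a single use of
    \<open>harris_prod\<close> correlates the factors of both sides.\<close>
  define H where "H k x = (if k \<in> A then h k (x k) else Z k x)" for k and x :: "'a \<Rightarrow> nat"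
  have p_sum: "sum (?p i) (?W i) = 1" for i using T by simp
  have p_nonneg: "0 \<le> ?p i v" for i v by simp
  have h_E: "prod_expect ?W ?p A (\<lambda>x. h a (x a)) = (\<Sum>v<T. h a v) / real T" if a: "a \<in> A" for a
    using prod_expect_prod[OF fin(1), of "{a}" ?p ?W "\<lambda>_. h a"] a p_sum
    by (simp add: sum_divide_distrib)
  \<comment> \<open>For \<open>x\<close> uniform on \<open>{..<T}\<close>, a fixed \<open>y\<close>
    exceeds each \<open>x a\<close> with probability \<open>min y T / T\<close>, independently over
    the neighbours.\<close>
  have Z_E: "prod_expect ?W ?p A (Z b) = (\<Sum>y<N. 1 + (real (min y T) / real T) ^ card {a \<in> A. R a b})" for b
  proof -
    let ?J = "{a \<in> A. R a b}"
    have finJ: "finite ?J" using fin by simp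
    have eq: "of_bool (\<forall>a\<in>A. R a b \<longrightarrow> x a < y) = (\<Prod>a\<in>?J. of_bool (x a < y) :: real)" for x y
      unfolding of_bool_Ball_eq_prod[OF finJ, symmetric] by auto
    have "prod_expect ?W ?p A (Z b)
        = (\<Sum>y<N. prod_expect ?W ?p A (\<lambda>x. 1 + 1 * (\<Prod>a\<in>?J. of_bool (x a < y))))"
      unfolding Z_def eq prod_expect_sum by simp
    also have "\<dots> = (\<Sum>y<N. 1 + (\<Prod>a\<in>?J. \<Sum>v<T. 1 / real T * of_bool (v < y)))"
    proof (rule sum.cong[OF refl])
      fix y
      have "prod_expect ?W ?p A (\<lambda>x. \<Prod>a\<in>?J. of_bool (x a < y)) = (\<Prod>a\<in>?J. \<Sum>v<T. 1 / real T * of_bool (v < y))"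
        using p_sum fin by (intro prod_expect_prod) auto
      then show "prod_expect ?W ?p A (\<lambda>x. 1 + 1 * (\<Prod>a\<in>?J. of_bool (x a < y)))
          = 1 + (\<Prod>a\<in>?J. \<Sum>v<T. 1 / real T * of_bool (v < y))"
        using prod_expect_affine[OF fin(1), of ?p ?W 1 1] p_sum by simp
    qed
    also have "\<dots> = (\<Sum>y<N. 1 + (real (min y T) / real T) ^ card ?J)"
      unfolding sum_distrib_left[symmetric] sum_of_bool_lessThan by simp
    finally show ?thesis .
  qed
  have h_nonneg: "0 \<le> h a v" if "v < T" for a v
  proof -
    have "real (Suc v) / real (2 * N - T) \<le> 1" using that T by simp
    then show ?thesis unfolding h_def by (simp add: power_le_one)
  qed
  have h_anti: "h a w \<le> h a v" if "v \<le> w" for a v w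
    unfolding h_def using that by (intro diff_left_mono power_mono divide_right_mono) auto
  have Z_nonneg: "0 \<le> Z b x" for b x unfolding Z_def by (intro sum_nonneg) auto
  \<comment> \<open>Larger labels on \<open>A\<close> lower all factors, hence the reversed
    order.\<close>
  have H_mono: "mono_labels (\<ge>) ?W A (H k)" for k
    unfolding mono_labels_def
  proof (intro ballI impI)
    fix f g assume fg: "f \<in> PiE A ?W" "g \<in> PiE A ?W" "\<forall>i\<in>A. g i \<le> f i"
    have "Z k f \<le> Z k g"
      unfolding Z_def
    proof (intro sum_mono add_left_mono)
      fix y
      have "(\<forall>a\<in>A. R a k \<longrightarrow> f a < y) \<longrightarrow> (\<forall>a\<in>A. R a k \<longrightarrow> g a < y)"
        using fg(3) le_less_trans by blast
      then show "(of_bool (\<forall>a\<in>A. R a k \<longrightarrow> f a < y) :: real) \<le> of_bool (\<forall>a\<in>A. R a k \<longrightarrow> g a < y)"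
        by simp
    qed
    then show "H k f \<le> H k g" unfolding H_def using fg(3) h_anti by auto
  qed
  have H_nonneg: "0 \<le> H k f" if "f \<in> PiE A ?W" for k f
    unfolding H_def using that Z_nonneg h_nonneg by (auto dest: PiE_mem)
  have split: "(\<Prod>k\<in>A \<union> B. F k) = (\<Prod>a\<in>A. F a) * (\<Prod>b\<in>B. F b)" for F :: "'a \<Rightarrow> real"
    using fin disj by (rule prod.union_disjoint)
  have H_prod: "(\<Prod>k\<in>A \<union> B. H k x) = (\<Prod>a\<in>A. h a (x a)) * (\<Prod>b\<in>B. Z b x)" for x
    unfolding split H_def using disj by (intro arg_cong2[of _ _ _ _ "(*)"] prod.cong) auto
  have "(\<Prod>a\<in>A. \<Sum>v<T. h a v) * (\<Prod>b\<in>B. \<Sum>y<N. 1 + (real (min y T) / real T) ^ card {a \<in> A. R a b})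
      = real T ^ card A * (\<Prod>k\<in>A \<union> B. prod_expect ?W ?p A (H k))"
  proof -
    have "(\<Prod>b\<in>B. prod_expect ?W ?p A (H b)) = (\<Prod>b\<in>B. prod_expect ?W ?p A (Z b))"
    proof (intro prod.cong refl)
      fix b assume "b \<in> B"
      then have "H b = Z b" using disj by (auto simp: H_def fun_eq_iff)
      then show "prod_expect ?W ?p A (H b) = prod_expect ?W ?p A (Z b)" by simp
    qed
    moreover have "real T ^ card A * (\<Prod>a\<in>A. prod_expect ?W ?p A (H a)) = (\<Prod>a\<in>A. \<Sum>v<T. h a v)"
    proof -
      have "real T * prod_expect ?W ?p A (H a) = (\<Sum>v<T. h a v)" if "a \<in> A" for a
      proof -
        have "H a = (\<lambda>x. h a (x a))" using that by (simp add: H_def fun_eq_iff)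
        then show ?thesis using h_E[OF that] T by simp
      qed
      then have "(\<Prod>a\<in>A. real T * prod_expect ?W ?p A (H a)) = (\<Prod>a\<in>A. \<Sum>v<T. h a v)"
        by (intro prod.cong) auto
      then show ?thesis by (simp only: prod.distrib prod_constant)
    qed
    ultimately show ?thesis unfolding split Z_E by (simp add: mult.assoc[symmetric])
  qed
  also have "\<dots> \<le> real T ^ card A * prod_expect ?W ?p A (\<lambda>x. \<Prod>k\<in>A \<union> B. H k x)"
    by (intro mult_left_mono harris_prod[where le = "(\<ge>)"])
      (use fin p_sum H_mono H_nonneg in auto)
  also have "\<dots> = (\<Sum>x\<in>PiE A ?W. (\<Prod>a\<in>A. h a (x a)) * (\<Prod>b\<in>B. Z b x))"
    unfolding prod_expect_def H_prod using T
    by (simp add: sum_distrib_left power_one_over mult.assoc[symmetric])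
  also have "\<dots> \<le> (\<Sum>x\<in>PiE A ?W. G x)"
  proof (rule sum_mono)
    fix x assume "x \<in> PiE A ?W"
    then have "x a < T" if "a \<in> A" for a using that by (auto dest: PiE_mem)
    then show "(\<Prod>a\<in>A. h a (x a)) * (\<Prod>b\<in>B. Z b x) \<le> G x"
      unfolding h_def Z_def G_def using fin T by (intro harris_conditional) auto
  qed
  also have "\<dots> \<le> (\<Sum>x\<in>PiE A (\<lambda>_. {..<N}). G x)"
  proof (rule sum_mono2)
    show "finite (PiE A (\<lambda>_. {..<N}))" using fin by (simp add: finite_PiE)
    show "PiE A ?W \<subseteq> PiE A (\<lambda>_. {..<N})" using T by (intro PiE_mono) auto
  qed (auto simp: G_def intro!: sum_nonneg mult_nonneg_nonneg prod_nonneg)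
  also have "\<dots> = (\<Sum>f\<in>PiE (A \<union> B) (\<lambda>_. {..<N}). (\<Prod>a\<in>A. of_bool (\<exists>b\<in>B. R a b \<and> f a < f b))
            * (\<Prod>b\<in>B. 1 + of_bool (\<forall>a\<in>A. R a b \<longrightarrow> f a < f b)))"
    unfolding sum_PiE_Un[OF disj] G_def
  proof (intro sum.cong refl arg_cong2[of _ _ _ _ "(*)"] prod.cong)
    fix x y :: "'a \<Rightarrow> nat" and a assume a: "a \<in> A"
    have "(\<exists>b\<in>B. R a b \<and> x a < y b)
        \<longleftrightarrow> (\<exists>b\<in>B. R a b \<and> (if a \<in> A then x a else y a) < (if b \<in> A then x b else y b))"
      using a disj by (intro bex_cong) auto
    then show "(of_bool (\<exists>b\<in>B. R a b \<and> x a < y b) :: real)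
        = of_bool (\<exists>b\<in>B. R a b \<and> (if a \<in> A then x a else y a) < (if b \<in> A then x b else y b))"
      by (simp only:)
  next
    fix x y :: "'a \<Rightarrow> nat" and b assume "b \<in> B"
    then have "(\<forall>a\<in>A. R a b \<longrightarrow> x a < y b)
        \<longleftrightarrow> (\<forall>a\<in>A. R a b \<longrightarrow> (if a \<in> A then x a else y a) < (if b \<in> A then x b else y b))"
      using disj by (intro ball_cong) auto
    then show "1 + (of_bool (\<forall>a\<in>A. R a b \<longrightarrow> x a < y b) :: real)
        = 1 + of_bool (\<forall>a\<in>A. R a b \<longrightarrow> (if a \<in> A then x a else y a) < (if b \<in> A then x b else y b))"
      by (simp only:)
  qed
  finally show ?thesis unfolding h_def .
qed

subsection \<open>Contribution of a vertex\<close>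

text \<open>Mean value bounds for the increment of \<open>x ^ Suc d\<close>; they telescope to the
  comparison of power sums with the integral.\<close>

lemma power_Suc_diff_bounds:
  fixes x :: real
  assumes "0 \<le> x"
  shows "x ^ Suc d + real (Suc d) * x ^ d \<le> (x + 1) ^ Suc d"
    and "(x + 1) ^ Suc d \<le> x ^ Suc d + real (Suc d) * (x + 1) ^ d"
proof -
  show "x ^ Suc d + real (Suc d) * x ^ d \<le> (x + 1) ^ Suc d"
  proof (induction d)
    case (Suc d)
    have "(x + 1) * (x ^ Suc d + real (Suc d) * x ^ d) \<le> (x + 1) * (x + 1) ^ Suc d"
      using Suc assms by (intro mult_left_mono) auto
    moreover have "0 \<le> real (Suc d) * x ^ d" using assms by simp
    ultimately show ?case by (simp add: algebra_simps)
  qed simp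
  show "(x + 1) ^ Suc d \<le> x ^ Suc d + real (Suc d) * (x + 1) ^ d"
  proof (induction d)
    case (Suc d)
    have "(x + 1) * (x + 1) ^ Suc d \<le> (x + 1) * (x ^ Suc d + real (Suc d) * (x + 1) ^ d)"
      using Suc assms by (intro mult_left_mono) auto
    moreover have "x ^ Suc d \<le> (x + 1) ^ Suc d" using assms by (intro power_mono) auto
    ultimately show ?case by (simp add: algebra_simps)
  qed simp
qed

lemma sum_powers_bounds:
  "real (Suc d) * (\<Sum>x<n. real x ^ d) \<le> real n ^ Suc d"
  "real n ^ Suc d \<le> real (Suc d) * (\<Sum>x<n. real (Suc x) ^ d)"
proof -
  show "real (Suc d) * (\<Sum>x<n. real x ^ d) \<le> real n ^ Suc d"
  proof (induction n)
    case (Suc n)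
    then show ?case using power_Suc_diff_bounds(1)[of "real n" d]
      by (simp add: algebra_simps)
  qed simp
  show "real n ^ Suc d \<le> real (Suc d) * (\<Sum>x<n. real (Suc x) ^ d)"
  proof (induction n)
    case (Suc n)
    then show ?case using power_Suc_diff_bounds(2)[of "real n" d]
      by (simp add: algebra_simps)
  qed simp
qed

lemma sum_powers_shift:
  "(\<Sum>x<n. real (Suc x) ^ d) \<le> (\<Sum>x<n. real x ^ d) + real n ^ d"
  by (induction n) auto

text \<open>Left and right Riemann sums of \<open>t ^ d\<close> over the unit interval: the limit
  lies between them, and they differ by at most \<open>1 / n\<close>.\<close>

lemma tendsto_sum_powers:
  "(\<lambda>n. (\<Sum>x<n. real x ^ d) / real n ^ Suc d) \<longlonglongrightarrow> 1 / real (Suc d)"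
  "(\<lambda>n. (\<Sum>x<n. real (Suc x) ^ d) / real n ^ Suc d) \<longlonglongrightarrow> 1 / real (Suc d)"
proof -
  let ?S = "\<lambda>n. (\<Sum>x<n. real x ^ d) / real n ^ Suc d"
  let ?S' = "\<lambda>n. (\<Sum>x<n. real (Suc x) ^ d) / real n ^ Suc d"
  have le: "?S n \<le> 1 / real (Suc d)" "1 / real (Suc d) \<le> ?S' n" "?S' n \<le> ?S n + inverse (real n)"
    if n: "0 < n" for n
  proof -
    have pos: "0 < real n ^ Suc d" using n by simp
    show "?S n \<le> 1 / real (Suc d)" "1 / real (Suc d) \<le> ?S' n"
      using sum_powers_bounds(1)[of d n] sum_powers_bounds(2)[of n d] pos
      by (simp_all add: field_simps del: power_Suc)
    have "?S' n \<le> ((\<Sum>x<n. real x ^ d) + real n ^ d) / real n ^ Suc d"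
      using pos by (intro divide_right_mono sum_powers_shift) simp
    also have "\<dots> = ?S n + inverse (real n)"
      using n by (simp add: add_divide_distrib inverse_eq_divide)
    finally show "?S' n \<le> ?S n + inverse (real n)" .
  qed
  have ev: "\<forall>\<^sub>F n in sequentially. 0 < n" by (rule eventually_gt_at_top)
  have inv: "(\<lambda>n. inverse (real n)) \<longlonglongrightarrow> 0" by (rule lim_inverse_n)
  show "?S \<longlonglongrightarrow> 1 / real (Suc d)"
  proof (rule tendsto_sandwich)
    show "\<forall>\<^sub>F n in sequentially. 1 / real (Suc d) - inverse (real n) \<le> ?S n"
      using ev
    proof eventually_elim
      case (elim n)
      show ?case using le[OF elim] by linarith
    qed
    show "\<forall>\<^sub>F n in sequentially. ?S n \<le> 1 / real (Suc d)"
      using ev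
    proof eventually_elim
      case (elim n)
      show ?case using le[OF elim] by linarith
    qed
    show "(\<lambda>n. 1 / real (Suc d) - inverse (real n)) \<longlonglongrightarrow> 1 / real (Suc d)"
      using tendsto_diff[OF tendsto_const inv, of "1 / real (Suc d)"] by simp
  qed simp
  show "?S' \<longlonglongrightarrow> 1 / real (Suc d)"
  proof (rule tendsto_sandwich)
    show "\<forall>\<^sub>F n in sequentially. 1 / real (Suc d) \<le> ?S' n"
      using ev
    proof eventually_elim
      case (elim n)
      show ?case using le[OF elim] by linarith
    qed
    show "\<forall>\<^sub>F n in sequentially. ?S' n \<le> 1 / real (Suc d) + inverse (real n)"
      using ev
    proof eventually_elim
      case (elim n)
      show ?case using le[OF elim] by linarith
    qed
    show "(\<lambda>n. 1 / real (Suc d) + inverse (real n)) \<longlonglongrightarrow> 1 / real (Suc d)"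
      using tendsto_add[OF tendsto_const inv, of "1 / real (Suc d)"] by simp
  qed simp
qed

text \<open>The factor of a vertex of degree \<open>d\<close> in
  \<open>label_sum_lower_bound\<close>, divided by \<open>N\<close>: this one for the side that must
  have no active vertex, \<open>active_weight\<close> for the side gaining 2 per active
  vertex.\<close>

definition inactive_weight :: "nat \<Rightarrow> nat \<Rightarrow> nat \<Rightarrow> real" where
  "inactive_weight N T d = (\<Sum>x<T. 1 - (real (Suc x) / real (2 * N - T)) ^ d) / real N"

definition active_weight :: "nat \<Rightarrow> nat \<Rightarrow> nat \<Rightarrow> real" where
  "active_weight N T d = (\<Sum>y<N. 1 + (real (min y T) / real T) ^ d) / real N"

text \<open>Separates ratios of \<open>T\<close> and \<open>N\<close>, which are invariant under
  scaling, from a Riemann sum.\<close>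

lemma inactive_weight_eq:
  assumes "0 < T" "T \<le> N"
  shows "inactive_weight N T d = real T / real N *
    (1 - (real T / real (2 * N - T)) ^ d * ((\<Sum>x<T. real (Suc x) ^ d) / real T ^ Suc d))"
proof -
  have eq: "(\<Sum>x<T. 1 - (real (Suc x) / real (2 * N - T)) ^ d)
      = real T - (\<Sum>x<T. real (Suc x) ^ d) / real (2 * N - T) ^ d"
    by (simp add: sum_subtractf power_divide sum_divide_distrib)
  have key: "(t - S / c ^ d) / m = t / m * (1 - (t / c) ^ d * (S / t ^ Suc d))"
    if "0 < t" "0 < c" for t c m S :: real
    using that by (simp add: power_divide diff_divide_distrib right_diff_distrib)
  show ?thesis unfolding inactive_weight_def eq by (rule key) (use assms in auto)
qed

lemma active_weight_eq:
  assumes "0 < T" "T \<le> N"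
  shows "active_weight N T d = 1 + real (N - T) / real N
    + real T / real N * ((\<Sum>x<T. real x ^ d) / real T ^ Suc d)"
proof -
  have Un: "{..<N} = {..<T} \<union> {T..<N}" using assms by auto
  have "(\<Sum>y<N. (real (min y T) / real T) ^ d)
      = (\<Sum>y<T. (real (min y T) / real T) ^ d) + (\<Sum>y\<in>{T..<N}. (real (min y T) / real T) ^ d)"
    by (subst Un) (rule sum.union_disjoint, auto)
  also have "(\<Sum>y<T. (real (min y T) / real T) ^ d) = (\<Sum>y<T. real y ^ d) / real T ^ d"
    by (simp add: sum_divide_distrib power_divide)
  also have "(\<Sum>y\<in>{T..<N}. (real (min y T) / real T) ^ d) = (\<Sum>y\<in>{T..<N}. 1)"
    using assms by (intro sum.cong) auto
  finally have eq: "(\<Sum>y<N. 1 + (real (min y T) / real T) ^ d)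
      = real N + (\<Sum>y<T. real y ^ d) / real T ^ d + real (N - T)"
    by (simp add: sum.distrib)
  have key: "(m + S / t ^ d + e) / m = 1 + e / m + t / m * (S / t ^ Suc d)"
    if "0 < t" "0 < m" for t m e S :: real
    using that by (simp add: add_divide_distrib)
  show ?thesis unfolding active_weight_def eq by (rule key) (use assms in auto)
qed

text \<open>Here \<open>s = 1 / (q + 1)\<close>: for all \<open>M > 0\<close> the ratio
  \<open>T / N\<close> is \<open>1 - s\<close> and \<open>T / (2 * N - T)\<close> is
  \<open>(1 - s) / (1 + s) = q / (q + 2)\<close>, so only the Riemann sums vary with
  \<open>M\<close>.\<close>

lemma weight_limits:
  fixes q :: nat
  assumes q: "0 < q"
  shows "(\<lambda>M. inactive_weight ((q + 1) * M) (q * M) d)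
      \<longlonglongrightarrow> real q / (real q + 1) * (1 - (real q / (real q + 2)) ^ d / real (Suc d))" (is ?A)
    and "(\<lambda>M. active_weight ((q + 1) * M) (q * M) d)
      \<longlonglongrightarrow> (real q + 2) / (real q + 1) + real q / (real q + 1) / real (Suc d)" (is ?B)
proof -
  have lim: "filterlim (\<lambda>M. q * M) at_top sequentially"
    using q by (intro filterlim_subseq strict_monoI) simp
  have ratio: "real (q * M) / real ((q + 1) * M) = real q / (real q + 1)"
    "real (q * M) / real (2 * ((q + 1) * M) - q * M) = real q / (real q + 2)"
    "1 + real ((q + 1) * M - q * M) / real ((q + 1) * M) = (real q + 2) / (real q + 1)"
    if "0 < M" for M
  proof -
    have eq: "2 * ((q + 1) * M) - q * M = (q + 2) * M" "(q + 1) * M - q * M = M"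
      by (simp_all add: algebra_simps)
    have cast: "real ((q + j) * M) = (real q + real j) * real M" for j
      by (simp only: of_nat_mult of_nat_add)
    have M: "real M \<noteq> 0" using that by simp
    have "real (q * M) / real ((q + j) * M) = real q / (real q + real j)" for j
      unfolding cast unfolding of_nat_mult by (rule mult_divide_mult_cancel_right[OF M])
    from this[of 1] this[of 2]
    show "real (q * M) / real ((q + 1) * M) = real q / (real q + 1)"
      "real (q * M) / real (2 * ((q + 1) * M) - q * M) = real q / (real q + 2)"
      unfolding eq by (simp_all only: of_nat_1 of_nat_numeral)
    have "1 + real M / ((real q + 1) * real M) = (real q + 2) / (real q + 1)"
      using M by (simp add: add_divide_eq_if_simps(1) divide_simps)
    then show "1 + real ((q + 1) * M - q * M) / real ((q + 1) * M) = (real q + 2) / (real q + 1)"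
      unfolding eq cast of_nat_1 .
  qed
  have ev: "\<forall>\<^sub>F M in sequentially. (0::nat) < M" by (rule eventually_gt_at_top)
  let ?r = "real q / (real q + 1)"
  have "(\<lambda>M. ?r * (1 - (real q / (real q + 2)) ^ d
          * ((\<Sum>x<q * M. real (Suc x) ^ d) / real (q * M) ^ Suc d)))
      \<longlonglongrightarrow> ?r * (1 - (real q / (real q + 2)) ^ d * (1 / real (Suc d)))"
    by (intro tendsto_intros filterlim_compose[OF tendsto_sum_powers(2) lim])
  moreover have "\<forall>\<^sub>F M in sequentially. ?r * (1 - (real q / (real q + 2)) ^ d
          * ((\<Sum>x<q * M. real (Suc x) ^ d) / real (q * M) ^ Suc d))
      = inactive_weight ((q + 1) * M) (q * M) d"
    using ev
  proof eventually_elim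
    case (elim M)
    then have *: "0 < q * M" "q * M \<le> (q + 1) * M" using q by auto
    show ?case unfolding inactive_weight_eq[OF *] ratio[OF elim] ..
  qed
  ultimately show ?A by (simp add: Lim_transform_eventually)
  have "(\<lambda>M. (real q + 2) / (real q + 1) + ?r * ((\<Sum>x<q * M. real x ^ d) / real (q * M) ^ Suc d))
      \<longlonglongrightarrow> (real q + 2) / (real q + 1) + ?r * (1 / real (Suc d))"
    by (intro tendsto_intros filterlim_compose[OF tendsto_sum_powers(1) lim])
  moreover have "\<forall>\<^sub>F M in sequentially.
      (real q + 2) / (real q + 1) + ?r * ((\<Sum>x<q * M. real x ^ d) / real (q * M) ^ Suc d)
      = active_weight ((q + 1) * M) (q * M) d"
    using ev
  proof eventually_elim
    case (elim M)
    then have *: "0 < q * M" "q * M \<le> (q + 1) * M" using q by auto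
    show ?case unfolding active_weight_eq[OF *] ratio[OF elim] ..
  qed
  ultimately show ?B by (simp add: Lim_transform_eventually)
qed

section \<open>The numerical inequality for the limiting weights\<close>

lemma binomial_lower_bound:
  fixes x :: real
  assumes "0 \<le> x"
  shows "1 + real m * x + real m * (real m - 1) / 2 * x\<^sup>2 \<le> (1 + x) ^ m"
proof (induction m)
  case (Suc m)
  have "(1 + x) * (1 + real m * x + real m * (real m - 1) / 2 * x\<^sup>2) \<le> (1 + x) ^ Suc m"
    using Suc assms by (simp add: mult_left_mono)
  moreover have "0 \<le> real m * (real m - 1) / 2 * x ^ 3"
    using assms by (cases m) auto
  moreover have "(1 + x) * (1 + real m * x + real m * (real m - 1) / 2 * x\<^sup>2)
    = 1 + real (Suc m) * x + real (Suc m) * (real (Suc m) - 1) / 2 * x\<^sup>2 + real m * (real m - 1) / 2 * x ^ 3"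
    by (simp add: field_simps power2_eq_square power3_eq_cube)
  ultimately show ?case by linarith
qed simp

text \<open>For large \<open>n\<close> the factor \<open>q\<^sup>2 - n\<close> may drop to 1; for
  small \<open>n\<close> the factor \<open>n - 2\<close> is small and \<open>q\<^sup>2 / n\<close>
  is large. Hence, after cancelling \<open>q\<^sup>2 + 2 * q\<close>, the case split at
  \<open>n = q\<close>.\<close>

lemma weight_polynomial_ineq:
  fixes q n :: real
  assumes q: "8 \<le> q" and n: "5 \<le> n" "n \<le> q\<^sup>2 - 1" "q \<le> n * (n - 2)"
  shows "q\<^sup>2 + 2 * q + q\<^sup>2 / n
    < (q\<^sup>2 - n) * (1 + (n - 1) * (2 / q) + (n - 1) * (n - 2) / 2 * (2 / q)\<^sup>2)"
proof -
  define u where "u = q\<^sup>2 - n"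
  have u1: "1 \<le> u" using n by (simp add: u_def)
  have ident: "u * (1 + (n - 1) * (2 / q) + (n - 1) * (n - 2) / 2 * (2 / q)\<^sup>2) - q\<^sup>2 - 2 * q
      = u * (n - 2) * (2 * (n - 1) / q\<^sup>2 + 2 / q) - 2 * n / q - n"
    using q unfolding u_def by (simp add: field_simps power2_eq_square)
  have "2 * n / q + n + q\<^sup>2 / n < u * (n - 2) * (2 * (n - 1) / q\<^sup>2 + 2 / q)"
  proof (cases "q \<le> n")
    case True
    \<comment> \<open>This rearranges to \<open>u * (n - 2) \<ge> u + n - 3\<close>, which is
      \<open>q\<^sup>2 - 3\<close>.\<close>
    have "0 \<le> (u - 1) * (n - 3)" using u1 n by simp
    then have un: "q\<^sup>2 - 3 \<le> u * (n - 2)" by (simp add: u_def algebra_simps)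
    have q2: "64 \<le> q\<^sup>2" using q power_mono[of 8 q 2] by simp
    \<comment> \<open>The constants are values at the extreme \<open>q = 8\<close>:
      \<open>61 / 64\<close> is \<open>(q\<^sup>2 - 3) / q\<^sup>2\<close> and \<open>3 / 4\<close>
      is \<open>6 / q\<close>.\<close>
    have "61 / 32 * (n - 1) + (2 * q - 3 / 4) \<le> (q\<^sup>2 - 3) * (2 * (n - 1) / q\<^sup>2) + (q\<^sup>2 - 3) * (2 / q)"
    proof (rule add_mono)
      have "61 / 64 \<le> (q\<^sup>2 - 3) / q\<^sup>2" using q2 by (subst pos_le_divide_eq) auto
      then have "61 / 64 * (2 * (n - 1)) \<le> (q\<^sup>2 - 3) / q\<^sup>2 * (2 * (n - 1))"
        using n by (intro mult_right_mono) auto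
      then show "61 / 32 * (n - 1) \<le> (q\<^sup>2 - 3) * (2 * (n - 1) / q\<^sup>2)"
        by (simp only: times_divide_eq_left times_divide_eq_right)
      have "6 / q \<le> 3 / 4" using q by (simp add: field_simps)
      moreover have "(q\<^sup>2 - 3) * (2 / q) = 2 * q - 6 / q"
        using q by (simp add: field_simps power2_eq_square)
      ultimately show "2 * q - 3 / 4 \<le> (q\<^sup>2 - 3) * (2 / q)" by linarith
    qed
    also have "\<dots> = (q\<^sup>2 - 3) * (2 * (n - 1) / q\<^sup>2 + 2 / q)" by (simp only: distrib_left)
    also have "\<dots> \<le> u * (n - 2) * (2 * (n - 1) / q\<^sup>2 + 2 / q)"
      using un n q by (intro mult_right_mono) auto
    finally have 1: "61 / 32 * (n - 1) + (2 * q - 3 / 4) \<le> u * (n - 2) * (2 * (n - 1) / q\<^sup>2 + 2 / q)" .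
    have "2 * n / q \<le> n / 4" using q n by (simp add: field_simps)
    moreover have "q\<^sup>2 / n \<le> q"
      using True n q by (simp add: field_simps power2_eq_square mult_left_mono)
    ultimately have "2 * n / q + n + q\<^sup>2 / n < 61 / 32 * (n - 1) + (2 * q - 3 / 4)"
      using n(1) q by argo
    then show ?thesis using 1 by (rule less_le_trans)
  next
    case False
    have "2 * (q - 1) * (n - 2) = (q\<^sup>2 - q) * (n - 2) * (2 / q)"
      using q by (simp add: field_simps power2_eq_square)
    also have "\<dots> \<le> u * (n - 2) * (2 / q)"
      using False n q by (intro mult_right_mono) (auto simp: u_def)
    also have "\<dots> \<le> u * (n - 2) * (2 * (n - 1) / q\<^sup>2 + 2 / q)"
      using n q u1 by (intro mult_left_mono) auto
    finally have 1: "2 * (q - 1) * (n - 2) \<le> u * (n - 2) * (2 * (n - 1) / q\<^sup>2 + 2 / q)" .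
    have small: "2 * n / q \<le> 2" using False q by (simp add: field_simps)
    have frac: "q\<^sup>2 / n \<le> q * (n - 2)"
    proof -
      have "q * q \<le> q * (n * (n - 2))" using n q by (intro mult_left_mono) auto
      then show ?thesis using n by (simp add: field_simps power2_eq_square)
    qed
    have large: "6 * (n - 2) \<le> (q - 2) * (n - 2)" using n q by (intro mult_right_mono) auto
    \<comment> \<open>The part \<open>q * (n - 2)\<close> pays for \<open>q\<^sup>2 / n\<close>, the
      rest for \<open>2 * n / q + n\<close>.\<close>
    have split: "2 * (q - 1) * (n - 2) = q * (n - 2) + (q - 2) * (n - 2)" by (simp add: algebra_simps)
    have "a + n + b < z" if "a \<le> 2" "b \<le> x" "6 * (n - 2) \<le> y" "z = x + y" for a b x y z
      using that n(1) by argo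
    from this[OF small frac large split]
    have "2 * n / q + n + q\<^sup>2 / n < 2 * (q - 1) * (n - 2)" .
    then show ?thesis using 1 by (rule less_le_trans)
  qed
  then show ?thesis using ident unfolding u_def by linarith
qed

text \<open>The left factor is the limit of \<open>inactive_weight\<close> and the right one that of \<open>active_weight\<close>, for
  degree \<open>n - 1\<close>. After clearing denominators the claim is
  \<open>(q / (q + 2)) ^ (n - 1) * (q\<^sup>2 + 2 q + q\<^sup>2 / n) < q\<^sup>2 - n\<close>; for \<open>q \<ge> 8\<close> the quadratic part of the binomial
  expansion of \<open>(1 + 2 / q) ^ (n - 1)\<close> suffices, but for \<open>q = 3\<close> it does not.\<close>

lemma weight_product_gt_one:
  fixes k n :: nat
  assumes k: "2 \<le> k" and n: "k + 2 \<le> n" "n \<le> (k\<^sup>2 - 1)\<^sup>2 - 1"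
  defines "q \<equiv> real (k\<^sup>2 - 1)"
  shows "1 < q / (q + 1) * (1 - (q / (q + 2)) ^ (n - 1) / real n) * ((q + 2) / (q + 1) + q / (q + 1) / real n)"
proof -
  have k4: "4 \<le> k\<^sup>2" using power_mono[OF k, of 2] by simp
  have qk: "q = (real k)\<^sup>2 - 1" using k4 by (simp add: q_def of_nat_diff)
  have q3: "3 \<le> q" using power_mono[of 2 "real k" 2] k by (simp add: qk)
  have "1 \<le> (k\<^sup>2 - 1)\<^sup>2" using k4 by simp
  then have nq: "real n \<le> q\<^sup>2 - 1"
    using n(2) unfolding q_def by (metis of_nat_1 of_nat_diff of_nat_le_iff of_nat_power)
  have n4: "4 \<le> real n" using k n by simp
  \<comment> \<open>The cleared form of the claim, multiplied by
    \<open>((q + 2) / q) ^ (n - 1)\<close>, the inverse of \<open>\<rho>\<close> below.\<close>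
  have core: "q\<^sup>2 + 2 * q + q\<^sup>2 / real n < (q\<^sup>2 - real n) * (1 + 2 / q) ^ (n - 1)"
  proof (cases "k = 2")
    case True
    \<comment> \<open>The length bounds leave five values of \<open>n\<close>, each checked
      numerically.\<close>
    then have "q = 3" "n \<in> {4, 5, 6, 7, 8}" using n by (auto simp: q_def)
    then show ?thesis by (auto simp: power2_eq_square eval_nat_numeral)
  next
    case False
    have k3: "3 \<le> real k" using k False by simp
    have q8: "8 \<le> q" using power_mono[OF k3, of 2] by (simp add: qk)
    have n5: "5 \<le> real n" "real k + 2 \<le> real n" using k n False by auto
    \<comment> \<open>The lower bound on the length enters here:
      \<open>k\<^sup>2 - 1 \<le> (k + 2) * k \<le> n * (n - 2)\<close>.\<close>
    have "q \<le> (real k + 2) * real k" by (simp add: qk power2_eq_square algebra_simps)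
    also have "\<dots> \<le> real n * (real n - 2)" using n5 by (intro mult_mono) auto
    finally have "q\<^sup>2 + 2 * q + q\<^sup>2 / real n < (q\<^sup>2 - real n) *
        (1 + (real n - 1) * (2 / q) + (real n - 1) * (real n - 2) / 2 * (2 / q)\<^sup>2)"
      by (intro weight_polynomial_ineq q8 n5 nq)
    also have "\<dots> \<le> (q\<^sup>2 - real n) * (1 + 2 / q) ^ (n - 1)"
      using binomial_lower_bound[of "2 / q" "n - 1"] q3 n4 nq
      by (intro mult_left_mono) (auto simp: of_nat_diff)
    finally show ?thesis .
  qed
  define \<rho> where "\<rho> = (q / (q + 2)) ^ (n - 1)"
  have "q / (q + 2) * (1 + 2 / q) = 1" using q3 by (simp add: divide_simps)
  then have inv: "\<rho> * (1 + 2 / q) ^ (n - 1) = 1"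
    unfolding \<rho>_def power_mult_distrib[symmetric] by (simp only: power_one)
  have "0 < \<rho>" using q3 by (simp add: \<rho>_def)
  with core have "\<rho> * (q\<^sup>2 + 2 * q + q\<^sup>2 / real n) < \<rho> * ((q\<^sup>2 - real n) * (1 + 2 / q) ^ (n - 1))"
    by (rule mult_strict_left_mono)
  also have "\<dots> = q\<^sup>2 - real n"
    unfolding mult.left_commute[of \<rho>] inv by simp
  finally have main: "\<rho> * (q\<^sup>2 + 2 * q + q\<^sup>2 / real n) < q\<^sup>2 - real n" .
  define w where "w = 1 / real n"
  have w: "real n * w = 1" "0 < w" using n4 by (simp_all add: w_def)
  \<comment> \<open>The excess of the product over 1, scaled by \<open>(q + 1)\<^sup>2\<close>, is
    exactly \<open>w\<close> times the slack in \<open>main\<close>.\<close>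
  have "q * (1 - \<rho> * w) * (q + 2 + q * w) - (q + 1)\<^sup>2
      = w * (q\<^sup>2 - real n - \<rho> * (q\<^sup>2 + 2 * q + q\<^sup>2 * w))"
    using w(1) by algebra
  also have "\<dots> > 0" using main w(2) by (simp add: w_def)
  finally have "1 < q * (1 - \<rho> * w) * (q + 2 + q * w) / (q + 1)\<^sup>2" using q3 by simp
  also have "\<dots> = q / (q + 1) * (1 - \<rho> / real n) * ((q + 2 + q * w) / (q + 1))"
    by (simp add: w_def power2_eq_square)
  also have "(q + 2 + q * w) / (q + 1) = (q + 2) / (q + 1) + q / (q + 1) / real n"
    by (simp add: w_def add_divide_distrib)
  finally show ?thesis unfolding \<rho>_def .
qed

text \<open>The resolution is \<open>N = k\<^sup>2 M\<close>, \<open>T = (k\<^sup>2 - 1) M\<close> with \<open>M\<close> large, that is, the cut-off is at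
  \<open>1 - 1 / k\<^sup>2\<close>.\<close>

lemma exists_good_resolution:
  fixes k :: nat
  assumes k: "2 \<le> k"
  obtains N T where "0 < T" "T \<le> N"
    "\<And>d. k + 1 \<le> d \<Longrightarrow> Suc d \<le> (k\<^sup>2 - 1)\<^sup>2 - 1 \<Longrightarrow>
       0 < inactive_weight N T d \<and> 0 < active_weight N T d
       \<and> 1 \<le> inactive_weight N T d * active_weight N T d"
proof -
  define q where "q = k\<^sup>2 - 1"
  have "4 \<le> k\<^sup>2" using power_mono[OF k, of 2] by simp
  then have q: "0 < q" by (simp add: q_def)
  let ?I = "\<lambda>M. inactive_weight ((q + 1) * M) (q * M)" and ?A = "\<lambda>M. active_weight ((q + 1) * M) (q * M)"
  let ?D = "{d. k + 1 \<le> d \<and> Suc d \<le> (k\<^sup>2 - 1)\<^sup>2 - 1}"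
  have fin: "finite ?D" by (rule finite_subset[of _ "{..(k\<^sup>2 - 1)\<^sup>2}"]) auto
  \<comment> \<open>The limit product strictly exceeds 1 and both limits are positive, so the
    inequalities hold for large \<open>M\<close>; the finitely many degrees can share one
    \<open>M\<close>.\<close>
  have "\<forall>\<^sub>F M in sequentially. 0 < ?I M d \<and> 0 < ?A M d \<and> 1 \<le> ?I M d * ?A M d" if d: "d \<in> ?D" for d
  proof -
    let ?i = "real q / (real q + 1) * (1 - (real q / (real q + 2)) ^ d / real (Suc d))"
    let ?a = "(real q + 2) / (real q + 1) + real q / (real q + 1) / real (Suc d)"
    have gt: "1 < ?i * ?a"
      using weight_product_gt_one[OF k, of "Suc d"] d unfolding q_def[symmetric] by simp
    have a: "0 < ?a" by (intro add_pos_nonneg divide_pos_pos divide_nonneg_nonneg) (use q in auto)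
    have "0 < ?i * ?a" using gt by linarith
    then have i: "0 < ?i" using a by (rule zero_less_mult_pos2)
    have lim: "(\<lambda>M. ?I M d * ?A M d) \<longlonglongrightarrow> ?i * ?a"
      by (intro tendsto_mult weight_limits q)
    show ?thesis
      using order_tendstoD(1)[OF weight_limits(1)[OF q] i] order_tendstoD(1)[OF weight_limits(2)[OF q] a]
        order_tendstoD(1)[OF lim gt]
      by eventually_elim auto
  qed
  then have "\<forall>\<^sub>F M in sequentially. \<forall>d\<in>?D. 0 < ?I M d \<and> 0 < ?A M d \<and> 1 \<le> ?I M d * ?A M d"
    by (intro eventually_ball_finite fin ballI)
  then have "\<forall>\<^sub>F M in sequentially. 0 < M \<and> (\<forall>d\<in>?D. 0 < ?I M d \<and> 0 < ?A M d \<and> 1 \<le> ?I M d * ?A M d)"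
    by (intro eventually_conj eventually_gt_at_top)
  then obtain M where M: "0 < M" "\<forall>d\<in>?D. 0 < ?I M d \<and> 0 < ?A M d \<and> 1 \<le> ?I M d * ?A M d"
    using eventually_happens[of _ sequentially] by auto
  show ?thesis by (rule that[of "q * M" "(q + 1) * M"]) (use M q in auto)
qed

subsection \<open>Averaging over orders\<close>

text \<open>As \<open>0 ^ 0 = 1\<close>, the power of 0 is the indicator that no vertex of
  \<open>A\<close> is active for \<open>key\<close>. Strict label comparisons pass to keys, so ties
  can only lower the left side: a vertex of \<open>A\<close> with a neighbour of larger label is
  inactive for \<open>key\<close>, and a vertex of \<open>B\<close> active for \<open>f\<close> is
  active for \<open>key\<close>.\<close>

lemma activity_label_bound:
  fixes f key :: "'a \<Rightarrow> nat"
  assumes fin: "finite A" "finite B"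
    and key: "\<And>u v. u \<in> A \<union> B \<Longrightarrow> v \<in> A \<union> B \<Longrightarrow> f u < f v \<Longrightarrow> key u < key v"
  shows "(\<Prod>a\<in>A. of_bool (\<exists>b\<in>B. R a b \<and> f a < f b)) * (\<Prod>b\<in>B. 1 + of_bool (\<forall>a\<in>A. R a b \<longrightarrow> f a < f b))
       \<le> (0::real) ^ card {a \<in> A. \<forall>b\<in>B. R a b \<longrightarrow> key b < key a} * 2 ^ card {b \<in> B. \<forall>a\<in>A. R a b \<longrightarrow> key a < key b}"
proof (cases "{a \<in> A. \<forall>b\<in>B. R a b \<longrightarrow> key b < key a} = {}")
  case True
  let ?Q = "\<lambda>b. \<forall>a\<in>A. R a b \<longrightarrow> key a < key b"
  have "(\<Prod>a\<in>A. of_bool (\<exists>b\<in>B. R a b \<and> f a < f b) :: real) \<le> 1" by (intro prod_le_1) auto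
  moreover have "(\<Prod>b\<in>B. 1 + of_bool (\<forall>a\<in>A. R a b \<longrightarrow> f a < f b) :: real) \<le> (\<Prod>b\<in>B. if ?Q b then 2 else 1)"
  proof (intro prod_mono conjI)
    fix b assume "b \<in> B"
    then have "(\<forall>a\<in>A. R a b \<longrightarrow> f a < f b) \<longrightarrow> ?Q b" using key by blast
    then show "1 + of_bool (\<forall>a\<in>A. R a b \<longrightarrow> f a < f b) \<le> (if ?Q b then 2 else 1 :: real)" by simp
  qed simp
  moreover have "(\<Prod>b\<in>B. if ?Q b then 2 else 1 :: real) = 2 ^ card {b \<in> B. ?Q b}"
    using fin by (simp add: prod.If_cases Int_def)
  moreover have "0 \<le> (\<Prod>b\<in>B. 1 + of_bool (\<forall>a\<in>A. R a b \<longrightarrow> f a < f b) :: real)" by (intro prod_nonneg) auto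
  ultimately have "(\<Prod>a\<in>A. of_bool (\<exists>b\<in>B. R a b \<and> f a < f b)) * (\<Prod>b\<in>B. 1 + of_bool (\<forall>a\<in>A. R a b \<longrightarrow> f a < f b))
      \<le> 1 * (2::real) ^ card {b \<in> B. ?Q b}"
    by (intro mult_mono) auto
  then show ?thesis unfolding True by simp
next
  case False
  then obtain a where a: "a \<in> A" "\<forall>b\<in>B. R a b \<longrightarrow> key b < key a" by blast
  have "\<not> (\<exists>b\<in>B. R a b \<and> f a < f b)"
  proof
    assume "\<exists>b\<in>B. R a b \<and> f a < f b"
    then obtain b where b: "b \<in> B" "R a b" "f a < f b" by blast
    then have "key a < key b" using a(1) by (intro key) auto
    moreover have "key b < key a" using a(2) b by blast
    ultimately show False by simp
  qed
  then have "(\<Prod>a\<in>A. of_bool (\<exists>b\<in>B. R a b \<and> f a < f b) :: real) = 0"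
    using a(1) fin by (intro prod_zero) auto
  then show ?thesis by simp
qed

lemma label_sum_weights:
  fixes R :: "'a \<Rightarrow> 'a \<Rightarrow> bool" and N T :: nat
  assumes fin: "finite A" "finite B" and disj: "A \<inter> B = {}" and T: "0 < T" "T \<le> N"
  shows "real N ^ card (A \<union> B) * ((\<Prod>a\<in>A. inactive_weight N T (card {b \<in> B. R a b}))
         * (\<Prod>b\<in>B. active_weight N T (card {a \<in> A. R a b})))
       \<le> (\<Sum>f\<in>PiE (A \<union> B) (\<lambda>_. {..<N}). (\<Prod>a\<in>A. of_bool (\<exists>b\<in>B. R a b \<and> f a < f b))
            * (\<Prod>b\<in>B. 1 + of_bool (\<forall>a\<in>A. R a b \<longrightarrow> f a < f b)))"
proof -
  have "real N ^ card (A \<union> B) = (\<Prod>a\<in>A. real N) * (\<Prod>b\<in>B. real N)"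
    using fin disj by (simp add: card_Un_disjoint power_add)
  then have "real N ^ card (A \<union> B) * ((\<Prod>a\<in>A. inactive_weight N T (card {b \<in> B. R a b}))
         * (\<Prod>b\<in>B. active_weight N T (card {a \<in> A. R a b})))
      = (\<Prod>a\<in>A. real N * inactive_weight N T (card {b \<in> B. R a b}))
        * (\<Prod>b\<in>B. real N * active_weight N T (card {a \<in> A. R a b}))"
    by (simp add: prod.distrib)
  also have "\<dots> = (\<Prod>a\<in>A. \<Sum>x<T. 1 - (real (Suc x) / real (2 * N - T)) ^ card {b \<in> B. R a b})
       * (\<Prod>b\<in>B. \<Sum>y<N. 1 + (real (min y T) / real T) ^ card {a \<in> A. R a b})"
    unfolding inactive_weight_def active_weight_def using T by simp
  also note label_sum_lower_bound[OF assms]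
  finally show ?thesis .
qed

text \<open>The label is the leading part and the position in a fixed enumeration the last digit in
  base \<open>card E\<close>, so ties are broken without disturbing strict label
  comparisons.\<close>

lemma lexicographic_key:
  assumes "finite E"
  obtains idx :: "'a \<Rightarrow> nat" where
    "\<And>f :: 'a \<Rightarrow> nat. inj_on (\<lambda>e. f e * card E + idx e) E"
    "\<And>(f :: 'a \<Rightarrow> nat) u v. u \<in> E \<Longrightarrow> v \<in> E \<Longrightarrow> f u < f v \<Longrightarrow> f u * card E + idx u < f v * card E + idx v"
proof -
  obtain idx where idx: "bij_betw idx E {0..<card E}"
    using ex_bij_betw_finite_nat[OF assms] by blast
  have lt: "idx e < card E" if "e \<in> E" for e using idx that by (auto simp: bij_betw_def)
  have inj: "inj_on (\<lambda>e. f e * card E + idx e) E" for f :: "'a \<Rightarrow> nat"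
  proof (rule inj_onI)
    fix u v assume uv: "u \<in> E" "v \<in> E" "f u * card E + idx u = f v * card E + idx v"
    then have "(f u * card E + idx u) mod card E = (f v * card E + idx v) mod card E" by simp
    then have "idx u = idx v" using lt uv(1,2) by simp
    then show "u = v" using idx uv by (auto simp: bij_betw_def inj_on_def)
  qed
  have less: "f u * card E + idx u < f v * card E + idx v"
    if "u \<in> E" "v \<in> E" "f u < f v" for f :: "'a \<Rightarrow> nat" and u v
  proof -
    have "f u * card E + idx u < Suc (f u) * card E" using lt[OF that(1)] by simp
    also have "\<dots> \<le> f v * card E" using that(3) by (intro mult_le_mono1) simp
    finally show ?thesis by simp
  qed
  show ?thesis by (rule that[OF inj less])
qed

section \<open>From label sums to values of the Tutte polynomial\<close>

context matroid
begin

text \<open>The value \<open>t\<close> is the same for every order, so it can be averaged over all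
  \<open>N ^ card E\<close> labelings. \<open>P B\<close> is the side that must have no active
  element; keeping the sides abstract serves both evaluations.\<close>

lemma tutte_ge_label_sum:
  assumes T: "0 < T" "T \<le> N"
    and bound: "\<And>B. matroid_basis indep B \<Longrightarrow> P B \<union> Q B = E \<and> P B \<inter> Q B = {}"
    and expand: "\<And>key :: 'a \<Rightarrow> nat. inj_on key E \<Longrightarrow> t = (\<Sum>B | matroid_basis indep B.
        0 ^ card {a \<in> P B. \<forall>b\<in>Q B. R B a b \<longrightarrow> key b < key a}
        * 2 ^ card {b \<in> Q B. \<forall>a\<in>P B. R B a b \<longrightarrow> key a < key b})"
  shows "(\<Sum>B | matroid_basis indep B. (\<Prod>a\<in>P B. inactive_weight N T (card {b \<in> Q B. R B a b}))
         * (\<Prod>b\<in>Q B. active_weight N T (card {a \<in> P B. R B a b}))) \<le> t"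
proof -
  obtain idx :: "'a \<Rightarrow> nat" where idx: "\<And>f :: 'a \<Rightarrow> nat. inj_on (\<lambda>e. f e * card E + idx e) E"
    "\<And>(f :: 'a \<Rightarrow> nat) u v. u \<in> E \<Longrightarrow> v \<in> E \<Longrightarrow> f u < f v \<Longrightarrow> f u * card E + idx u < f v * card E + idx v"
    using lexicographic_key[OF finite_ground] by blast
  let ?L = "PiE E (\<lambda>_. {..<N})"
  let ?w = "\<lambda>B. (\<Prod>a\<in>P B. inactive_weight N T (card {b \<in> Q B. R B a b}))
         * (\<Prod>b\<in>Q B. active_weight N T (card {a \<in> P B. R B a b}))"
  let ?F = "\<lambda>B f. (\<Prod>a\<in>P B. of_bool (\<exists>b\<in>Q B. R B a b \<and> f a < f b))
            * (\<Prod>b\<in>Q B. 1 + of_bool (\<forall>a\<in>P B. R B a b \<longrightarrow> f a < f b)) :: real"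
  have fin: "finite (P B)" "finite (Q B)" if "matroid_basis indep B" for B
    using bound[OF that] finite_ground by (metis finite_Un)+
  have "real N ^ card E * (\<Sum>B | matroid_basis indep B. ?w B)
      \<le> (\<Sum>B | matroid_basis indep B. \<Sum>f\<in>?L. ?F B f)"
    unfolding sum_distrib_left
  proof (rule sum_mono)
    fix B assume "B \<in> {B. matroid_basis indep B}"
    then have B: "matroid_basis indep B" by simp
    have "P B \<union> Q B = E" "P B \<inter> Q B = {}" using bound[OF B] by auto
    then show "real N ^ card E * ?w B \<le> (\<Sum>f\<in>?L. ?F B f)"
      using label_sum_weights[OF fin[OF B] _ T, of "R B"] by simp
  qed
  also have "\<dots> = (\<Sum>f\<in>?L. \<Sum>B | matroid_basis indep B. ?F B f)" by (rule sum.swap)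
  also have "\<dots> \<le> (\<Sum>f\<in>?L. t)"
  proof (rule sum_mono)
    fix f :: "'a \<Rightarrow> nat"
    show "(\<Sum>B | matroid_basis indep B. ?F B f) \<le> t"
      unfolding expand[OF idx(1)[of f]]
    proof (rule sum_mono)
      fix B assume "B \<in> {B. matroid_basis indep B}"
      then have B: "matroid_basis indep B" by simp
      show "?F B f \<le> 0 ^ card {a \<in> P B. \<forall>b\<in>Q B. R B a b \<longrightarrow> f b * card E + idx b < f a * card E + idx a}
        * 2 ^ card {b \<in> Q B. \<forall>a\<in>P B. R B a b \<longrightarrow> f a * card E + idx a < f b * card E + idx b}"
        by (intro activity_label_bound fin B idx(2)) (use bound[OF B] in auto)
    qed
  qed
  also have "\<dots> = real N ^ card E * t"
    using finite_ground by (simp add: card_PiE)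
  finally show ?thesis using T by simp
qed

text \<open>At \<open>y = 0\<close> only bases without externally active elements survive, so
  \<open>E - B\<close> is the restricted side; at \<open>(0, 2)\<close> the roles are
  swapped.\<close>

lemma tutte_2_0_ge:
  assumes T: "0 < T" "T \<le> N"
  shows "(\<Sum>B | matroid_basis indep B.
      (\<Prod>b\<in>E - B. inactive_weight N T (card {a \<in> B. exchangeable indep B a b}))
      * (\<Prod>a\<in>B. active_weight N T (card {b \<in> E - B. exchangeable indep B a b}))) \<le> tutte E indep 2 0"
proof (rule tutte_ge_label_sum[OF T, where P = "\<lambda>B. E - B" and Q = "\<lambda>B. B"
      and R = "\<lambda>B b a. exchangeable indep B a b"])
  show "(E - B) \<union> B = E \<and> (E - B) \<inter> B = {}" if "matroid_basis indep B" for B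
    using basis_subset[OF that] by blast
  show "tutte E indep 2 0 = (\<Sum>B | matroid_basis indep B.
        0 ^ card {b \<in> E - B. \<forall>a\<in>B. exchangeable indep B a b \<longrightarrow> key a < key b}
        * 2 ^ card {a \<in> B. \<forall>b\<in>E - B. exchangeable indep B a b \<longrightarrow> key b < key a})"
    if "inj_on key E" for key :: "'a \<Rightarrow> nat"
    unfolding tutte_activities[OF that] int_active_def ext_active_def
    by (intro sum.cong refl mult.commute)
qed

lemma tutte_0_2_ge:
  assumes T: "0 < T" "T \<le> N"
  shows "(\<Sum>B | matroid_basis indep B.
      (\<Prod>a\<in>B. inactive_weight N T (card {b \<in> E - B. exchangeable indep B a b}))
      * (\<Prod>b\<in>E - B. active_weight N T (card {a \<in> B. exchangeable indep B a b}))) \<le> tutte E indep 0 2"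
proof (rule tutte_ge_label_sum[OF T, where P = "\<lambda>B. B" and Q = "\<lambda>B. E - B"
      and R = "\<lambda>B a b. exchangeable indep B a b"])
  show "B \<union> (E - B) = E \<and> B \<inter> (E - B) = {}" if "matroid_basis indep B" for B
    using basis_subset[OF that] by blast
  show "tutte E indep 0 2 = (\<Sum>B | matroid_basis indep B.
        0 ^ card {a \<in> B. \<forall>b\<in>E - B. exchangeable indep B a b \<longrightarrow> key b < key a}
        * 2 ^ card {b \<in> E - B. \<forall>a\<in>B. exchangeable indep B a b \<longrightarrow> key a < key b})"
    if "inj_on key E" for key :: "'a \<Rightarrow> nat"
    unfolding tutte_activities[OF that] int_active_def ext_active_def ..
qed

lemma tutte_1_1: "tutte E indep 1 1 = real (card {B. matroid_basis indep B})"
proof -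
  obtain key :: "'a \<Rightarrow> nat" where "inj_on key E"
    using finite_imp_inj_to_nat_seg[OF finite_ground] by blast
  then show ?thesis by (simp add: tutte_activities)
qed

text \<open>Each vertex carries its inactive weight in one lower bound and its active weight in the
  other, so for every basis the two summands multiply to at least 1. The number of bases is then at
  most the sum of \<open>sqrt (?v B) * sqrt (?w B)\<close>, which Cauchy--Schwarz splits into the
  two bounds.\<close>

theorem merino_welsh_of_degree_bounds:
  assumes T: "0 < T" "T \<le> N"
    and good: "\<And>d. d \<in> D \<Longrightarrow> 0 < inactive_weight N T d \<and> 0 < active_weight N T d
       \<and> 1 \<le> inactive_weight N T d * active_weight N T d"
    and deg: "\<And>B b. matroid_basis indep B \<Longrightarrow> b \<in> E - B \<Longrightarrow> card {a \<in> B. exchangeable indep B a b} \<in> D"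
    and codeg: "\<And>B a. matroid_basis indep B \<Longrightarrow> a \<in> B \<Longrightarrow> card {b \<in> E - B. exchangeable indep B a b} \<in> D"
  shows "(tutte E indep 1 1)\<^sup>2 \<le> tutte E indep 2 0 * tutte E indep 0 2"
proof -
  let ?I = "inactive_weight N T" and ?A = "active_weight N T"
  let ?d = "\<lambda>B b. card {a \<in> B. exchangeable indep B a b}"
    and ?c = "\<lambda>B a. card {b \<in> E - B. exchangeable indep B a b}"
  let ?v = "\<lambda>B. (\<Prod>b\<in>E - B. ?I (?d B b)) * (\<Prod>a\<in>B. ?A (?c B a))"
    and ?w = "\<lambda>B. (\<Prod>a\<in>B. ?I (?c B a)) * (\<Prod>b\<in>E - B. ?A (?d B b))"
  let ?\<B> = "{B. matroid_basis indep B}"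
  have pos: "0 < ?v B" "0 < ?w B" if "B \<in> ?\<B>" for B
    using that good deg codeg by (auto intro!: mult_pos_pos prod_pos)
  have vw: "1 \<le> ?v B * ?w B" if "B \<in> ?\<B>" for B
  proof -
    have "1 \<le> (\<Prod>b\<in>E - B. ?I (?d B b) * ?A (?d B b))" "1 \<le> (\<Prod>a\<in>B. ?I (?c B a) * ?A (?c B a))"
      using that good deg codeg by (auto intro!: prod_ge_1)
    then have "1 * 1 \<le> (\<Prod>b\<in>E - B. ?I (?d B b) * ?A (?d B b)) * (\<Prod>a\<in>B. ?I (?c B a) * ?A (?c B a))"
      by (intro mult_mono) auto
    then show ?thesis by (simp add: prod.distrib mult_ac)
  qed
  have "real (card ?\<B>) \<le> (\<Sum>B\<in>?\<B>. sqrt (?v B) * sqrt (?w B))"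
    using sum_mono[of ?\<B> "\<lambda>_. 1" "\<lambda>B. sqrt (?v B) * sqrt (?w B)"] vw
    by (simp add: real_sqrt_mult[symmetric])
  then have "(tutte E indep 1 1)\<^sup>2 \<le> (\<Sum>B\<in>?\<B>. sqrt (?v B) * sqrt (?w B))\<^sup>2"
    unfolding tutte_1_1 by (intro power_mono) auto
  also have "\<dots> \<le> (\<Sum>B\<in>?\<B>. (sqrt (?v B))\<^sup>2) * (\<Sum>B\<in>?\<B>. (sqrt (?w B))\<^sup>2)"
    by (rule Cauchy_Schwarz_ineq_sum)
  also have "\<dots> = (\<Sum>B\<in>?\<B>. ?v B) * (\<Sum>B\<in>?\<B>. ?w B)"
    using pos by (intro arg_cong2[of _ _ _ _ "(*)"] sum.cong real_sqrt_pow2 refl) (auto intro: less_imp_le)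
  also have "\<dots> \<le> tutte E indep 2 0 * tutte E indep 0 2"
  proof (rule mult_mono)
    show v: "(\<Sum>B\<in>?\<B>. ?v B) \<le> tutte E indep 2 0" using T by (rule tutte_2_0_ge)
    show "(\<Sum>B\<in>?\<B>. ?w B) \<le> tutte E indep 0 2" using T by (rule tutte_0_2_ge)
    show "0 \<le> (\<Sum>B\<in>?\<B>. ?w B)" using pos by (intro sum_nonneg less_imp_le)
    have "0 \<le> (\<Sum>B\<in>?\<B>. ?v B)" using pos by (intro sum_nonneg less_imp_le)
    then show "0 \<le> tutte E indep 2 0" using v by linarith
  qed
  finally show ?thesis .
qed

end

section \<open>Circuit lengths as degree bounds\<close>

theorem theorem1p4:
  fixes E :: "'a set" and indep :: "'a set \<Rightarrow> bool" and l :: int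
  assumes "matroid E indep"
    and "l \<ge> 4"
    and "\<And>C. matroid_circuit E indep C \<Longrightarrow>
           l \<le> int (card C) \<and> int (card C) \<le> (l - 2)^2 * (l^2 - 4 * l + 2)"
    and "\<And>C. matroid_circuit E (dual_indep E indep) C \<Longrightarrow>
           l \<le> int (card C) \<and> int (card C) \<le> (l - 2)^2 * (l^2 - 4 * l + 2)"
  shows "tutte E indep 2 0 * tutte E indep 0 2 \<ge> (tutte E indep 1 1)^2"
proof -
  interpret matroid E indep by (rule assms(1))
  define k where "k = nat (l - 2)"
  have k: "2 \<le> k" "l = int k + 2" using assms(2) by (auto simp: k_def)
  have "4 \<le> k\<^sup>2" using power_mono[OF k(1), of 2] by simp
  then have k2: "int (k\<^sup>2 - 1) = (int k)\<^sup>2 - 1" "1 \<le> (k\<^sup>2 - 1)\<^sup>2" by (simp_all add: of_nat_diff)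
  \<comment> \<open>With \<open>l = k + 2\<close>, \<open>l\<^sup>2 - 4 * l + 2\<close> is
    \<open>k\<^sup>2 - 2\<close>, and
    \<open>k\<^sup>2 * (k\<^sup>2 - 2) = (k\<^sup>2 - 1)\<^sup>2 - 1\<close>.\<close>
  have U: "(l - 2)\<^sup>2 * (l\<^sup>2 - 4 * l + 2) = int ((k\<^sup>2 - 1)\<^sup>2 - 1)"
    unfolding of_nat_diff[OF k2(2)] of_nat_power k2(1) k(2) by (simp add: power2_eq_square algebra_simps)
  \<comment> \<open>A degree is one less than a length, so the lower bound \<open>l\<close> becomes
    \<open>k + 1\<close>.\<close>
  define D where "D = {d. k + 1 \<le> d \<and> Suc d \<le> (k\<^sup>2 - 1)\<^sup>2 - 1}"
  obtain N T where NT: "0 < T" "T \<le> N"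
    and weights: "\<And>d. k + 1 \<le> d \<Longrightarrow> Suc d \<le> (k\<^sup>2 - 1)\<^sup>2 - 1 \<Longrightarrow>
       0 < inactive_weight N T d \<and> 0 < active_weight N T d
       \<and> 1 \<le> inactive_weight N T d * active_weight N T d"
    by (rule exists_good_resolution[OF k(1)]) (rule that)
  have good: "0 < inactive_weight N T d \<and> 0 < active_weight N T d
       \<and> 1 \<le> inactive_weight N T d * active_weight N T d" if "d \<in> D" for d
    using weights[of d] that unfolding D_def by blast
  have D: "d \<in> D" if "l \<le> int (Suc d) \<and> int (Suc d) \<le> (l - 2)\<^sup>2 * (l\<^sup>2 - 4 * l + 2)" for d
    using that k unfolding U D_def by auto
  show ?thesis
  proof (rule merino_welsh_of_degree_bounds[OF NT good])
    fix B b assume B: "matroid_basis indep B" and b: "b \<in> E - B"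
    let ?X = "{a \<in> B. exchangeable indep B a b}"
    have "card (insert b ?X) = Suc (card ?X)" using b basis_finite[OF B] by simp
    then show "card ?X \<in> D" using assms(3)[OF fundamental_circuit[OF B b]] by (intro D) simp
  next
    fix B a assume B: "matroid_basis indep B" and a: "a \<in> B"
    let ?X = "{b \<in> E - B. exchangeable indep B a b}"
    have "card (insert a ?X) = Suc (card ?X)" using a finite_ground by simp
    then show "card ?X \<in> D" using assms(4)[OF fundamental_cocircuit[OF B a]] by (intro D) simp
  qed
qed

end
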